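(* Let $(\Omega,\mathcal F,\mathbb P)$ be a probability space and $L^0=L^0(\Omega,\mathcal F,\mathbb P)$. Let $(E,\|\cdot\|)$ be an $L^0$-normed module whose sum preserves the relative stability, and let $\{x_\gamma\}_{\gamma\in\Gamma}$ be a net in $E$ which converges weakly (i.e. for the topology $\sigma(E,E^* )$) to $x\in E$. Then, for any $\varepsilon\in L^0_{++}$, there exists $$z_\varepsilon\in \overline{co_{L^0}\{x_\gamma : \gamma\in\Gamma\}}^{\,cc}$$ such that $\|x-z_\varepsilon\|\le\varepsilon$. Here $\overline{co_{L^0}\{x_\gamma:\gamma\in\Gamma\}}^{\,cc}$ is the stable hull of the $L^0$-convex hull of $\{x_\gamma:\gamma\in\Gamma\}$.
   Context: $L^0$ is the ring of equivalence classes (modulo a.s. equality) of real-valued $\mathcal F$-measurable random variables, ordered by almost sure dominance: $\eta\ge\xi$ means $\mathbb P(\eta\ge\xi)=1$, and $\eta>\xi$ means $\mathbb P(\eta>\xi)=1$. $L^0_+=\{\eta\in L^0:\eta\ge0\}$, $L^0_{++}=\{\eta\in L^0:\eta>0\}$. $L^0$ carries the topology with base $\{\eta+B_\varepsilon : \eta\in L^0,\varepsilon\in L^0_{++}\}$, where $B_\varepsilon=\{\xi\in L^0:|\xi|\le\varepsilon\}$. An $L^0$-seminorm on an $L^0$-module $E$ is a map $\|\cdot\|:E\to L^0_+$ with $\|\eta x\|=|\eta|\|x\|$ and $\|x+y\|\le\|x\|+\|y\|$ for all $\eta\in L^0$, $x,y\in E$; it is an $L^0$-norm if moreover $\|x\|=0$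 implies $x=0$. A family $\mathscr P$ of $L^0$-seminorms induces the topology on $E$ (translation invariant) with neighborhood base of $0$ given by the sets $\{x\in E:\|x\|_F\le\varepsilon\}$, $\varepsilon\in L^0_{++}$, $F\subset\mathscr P$ finite, where $\|x\|_F=\operatorname{ess\,sup}\{\|x\|:\|\cdot\|\in F\}$. An $L^0$-normed module is an $L^0$-module with an $L^0$-norm, endowed with the induced topology. $E^*$ is the set of all $L^0$-linear continuous maps $\mu:E\to L^0$. The weak topology $\sigma(E,E^* )$ is the one induced by the $L^0$-seminorms $x\mapsto|x^*(x)|$, $x^*\in E^*$. Let $\mathcal A$ be the measure algebra of $\mathcal F$ (events modulo null sets). $\Pi(\Omega)$ is the set of countable families $\{A_k\}_{k\in\mathbb N}\subset\mathcal A$ that are pairwise disjoint with supremum $\Omega$ (some $A_k$ may be null). Given a sequence $\{x_k\}$ in $E$ and $\{A_k\}\in\Pi(\Omega)$, an element $x\in E$ is a concatenation of $\{x_k\}$ along $\{A_k\}$ if $1_{A_k}x=1_{A_k}x_k$ for all $k$. A subset $K\subset E$ is relatively stable if every concatenation $x\in E$ of a sequence in $K$ along a partition in $\Pi(\Omega)$ belongs to $K$ (existence of concatenations is not required). The sum of $E$ preserves the relative stability if $L+M$ is relatively stable whenever $L,M\subset E$ are relatively stable. For $A\subset E$, the $L^0$-convex hull is $co_{L^0}(A)=\{\sum_{i\in I}\eta_ix_i : I\text{ finite},\ x_i\in A,\ \eta_i\in L^0_+,\ \sum_{i\in I}\eta_i=1\}$, and the stable hull $\overline{A}^{cc}$ is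 the set of all $x\in E$ that are concatenations of some sequence in $A$ along some partition in $\Pi(\Omega)$. *)

theory Defs
  imports "HOL-Probability.Probability" "HOL-Algebra.Module" "HOL-Algebra.AbelCoset"
begin

section \<open>The ordered ring of random variables modulo almost sure equality\<close>

definition ae_eq_rel :: "'w measure \<Rightarrow> (('w \<Rightarrow> real) \<times> ('w \<Rightarrow> real)) set" where
  "ae_eq_rel M = {(f, g). f \<in> borel_measurable M \<and> g \<in> borel_measurable M \<and>
     (AE w in M. f w = g w)}"

definition L0_class :: "'w measure \<Rightarrow> ('w \<Rightarrow> real) \<Rightarrow> ('w \<Rightarrow> real) set" where
  "L0_class M f = ae_eq_rel M `` {f}"

definition L0 :: "'w measure \<Rightarrow> ('w \<Rightarrow> real) set ring" where
  "L0 M = \<lparr>carrier = borel_measurable M // ae_eq_rel M,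
           mult = \<lambda>X Y. \<Union>f\<in>X. \<Union>g\<in>Y. L0_class M (\<lambda>w. f w * g w),
           one = L0_class M (\<lambda>_. 1),
           zero = L0_class M (\<lambda>_. 0),
           add = \<lambda>X Y. \<Union>f\<in>X. \<Union>g\<in>Y. L0_class M (\<lambda>w. f w + g w)\<rparr>"

definition L0_le :: "'w measure \<Rightarrow> ('w \<Rightarrow> real) set \<Rightarrow> ('w \<Rightarrow> real) set \<Rightarrow> bool" where
  "L0_le M X Y \<longleftrightarrow> (\<exists>f\<in>X. \<exists>g\<in>Y. AE w in M. f w \<le> g w)"

text \<open>The strict order is strict almost everywhere, so it is not
  ``\<open>\<le>\<close> and \<open>\<noteq>\<close>''.\<close>

definition L0_less :: "'w measure \<Rightarrow> ('w \<Rightarrow> real) set \<Rightarrow> ('w \<Rightarrow> real) set \<Rightarrow> bool" where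
  "L0_less M X Y \<longleftrightarrow> (\<exists>f\<in>X. \<exists>g\<in>Y. AE w in M. f w < g w)"

definition L0_abs :: "'w measure \<Rightarrow> ('w \<Rightarrow> real) set \<Rightarrow> ('w \<Rightarrow> real) set" where
  "L0_abs M X = (\<Union>f\<in>X. L0_class M (\<lambda>w. \<bar>f w\<bar>))"

definition L0_nonneg :: "'w measure \<Rightarrow> ('w \<Rightarrow> real) set set" where
  "L0_nonneg M = {X \<in> carrier (L0 M). L0_le M \<zero>\<^bsub>L0 M\<^esub> X}"

definition L0_pos :: "'w measure \<Rightarrow> ('w \<Rightarrow> real) set set" where
  "L0_pos M = {X \<in> carrier (L0 M). L0_less M \<zero>\<^bsub>L0 M\<^esub> X}"

definition L0_indicator :: "'w measure \<Rightarrow> 'w set \<Rightarrow> ('w \<Rightarrow> real) set" where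
  "L0_indicator M A = L0_class M (indicator A)"

definition is_L0_esssup :: "'w measure \<Rightarrow> ('w \<Rightarrow> real) set set \<Rightarrow> ('w \<Rightarrow> real) set \<Rightarrow> bool" where
  "is_L0_esssup M S s \<longleftrightarrow> s \<in> L0_nonneg M \<and> (\<forall>X\<in>S. L0_le M X s) \<and>
     (\<forall>t\<in>L0_nonneg M. (\<forall>X\<in>S. L0_le M X t) \<longrightarrow> L0_le M s t)"

text \<open>The least upper bound is taken among nonnegative elements, so that the essential supremum of
  the empty family of seminorms is \<open>0\<close>.\<close>

definition L0_esssup :: "'w measure \<Rightarrow> ('w \<Rightarrow> real) set set \<Rightarrow> ('w \<Rightarrow> real) set" where
  "L0_esssup M S = (THE s. is_L0_esssup M S s)"

definition L0_ball :: "'w measure \<Rightarrow> ('w \<Rightarrow> real) set \<Rightarrow> ('w \<Rightarrow> real) set set" where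
  "L0_ball M \<epsilon> = {\<xi> \<in> carrier (L0 M). L0_le M (L0_abs M \<xi>) \<epsilon>}"

text \<open>The sets \<open>\<eta> + B\<^sub>\<epsilon>\<close> are a base of neighbourhoods of \<open>\<eta>\<close>; they need not be open themselves
  (for a one-point space they are the compact intervals of the real line).\<close>

definition L0_topology :: "'w measure \<Rightarrow> ('w \<Rightarrow> real) set topology" where
  "L0_topology M = topology (\<lambda>U. U \<subseteq> carrier (L0 M) \<and>
     (\<forall>\<eta>\<in>U. \<exists>\<epsilon>\<in>L0_pos M. (\<lambda>\<xi>. \<eta> \<oplus>\<^bsub>L0 M\<^esub> \<xi>) ` L0_ball M \<epsilon> \<subseteq> U))"

section \<open>Normed modules and the weak topology\<close>

definition L0_seminorm ::
    "'w measure \<Rightarrow> (('w \<Rightarrow> real) set, 'e, 'm) module_scheme \<Rightarrow> ('e \<Rightarrow> ('w \<Rightarrow> real) set) \<Rightarrow> bool" where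
  "L0_seminorm M E p \<longleftrightarrow> p \<in> carrier E \<rightarrow> L0_nonneg M \<and>
     (\<forall>\<eta>\<in>carrier (L0 M). \<forall>x\<in>carrier E. p (\<eta> \<odot>\<^bsub>E\<^esub> x) = L0_abs M \<eta> \<otimes>\<^bsub>L0 M\<^esub> p x) \<and>
     (\<forall>x\<in>carrier E. \<forall>y\<in>carrier E. L0_le M (p (x \<oplus>\<^bsub>E\<^esub> y)) (p x \<oplus>\<^bsub>L0 M\<^esub> p y))"

definition L0_norm ::
    "'w measure \<Rightarrow> (('w \<Rightarrow> real) set, 'e, 'm) module_scheme \<Rightarrow> ('e \<Rightarrow> ('w \<Rightarrow> real) set) \<Rightarrow> bool" where
  "L0_norm M E p \<longleftrightarrow> L0_seminorm M E p \<and>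
     (\<forall>x\<in>carrier E. p x = \<zero>\<^bsub>L0 M\<^esub> \<longrightarrow> x = \<zero>\<^bsub>E\<^esub>)"

definition L0_normed_module ::
    "'w measure \<Rightarrow> (('w \<Rightarrow> real) set, 'e, 'm) module_scheme \<Rightarrow> ('e \<Rightarrow> ('w \<Rightarrow> real) set) \<Rightarrow> bool" where
  "L0_normed_module M E p \<longleftrightarrow> Module.module (L0 M) E \<and> L0_norm M E p"

definition seminorm_nbhd ::
    "'w measure \<Rightarrow> (('w \<Rightarrow> real) set, 'e, 'm) module_scheme \<Rightarrow>
     ('e \<Rightarrow> ('w \<Rightarrow> real) set) set \<Rightarrow> ('w \<Rightarrow> real) set \<Rightarrow> 'e set" where
  "seminorm_nbhd M E F \<epsilon> =
     {y \<in> carrier E. L0_le M (L0_esssup M ((\<lambda>p. p y) ` F)) \<epsilon>}"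

definition seminorm_topology ::
    "'w measure \<Rightarrow> (('w \<Rightarrow> real) set, 'e, 'm) module_scheme \<Rightarrow>
     ('e \<Rightarrow> ('w \<Rightarrow> real) set) set \<Rightarrow> 'e topology" where
  "seminorm_topology M E P = topology (\<lambda>U. U \<subseteq> carrier E \<and>
     (\<forall>x\<in>U. \<exists>F \<epsilon>. finite F \<and> F \<subseteq> P \<and> \<epsilon> \<in> L0_pos M \<and>
        (\<lambda>y. x \<oplus>\<^bsub>E\<^esub> y) ` seminorm_nbhd M E F \<epsilon> \<subseteq> U))"

definition L0_dual ::
    "'w measure \<Rightarrow> (('w \<Rightarrow> real) set, 'e, 'm) module_scheme \<Rightarrow> ('e \<Rightarrow> ('w \<Rightarrow> real) set) \<Rightarrow>
     ('e \<Rightarrow> ('w \<Rightarrow> real) set) set" where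
  "L0_dual M E p = {\<mu> \<in> carrier E \<rightarrow>\<^sub>E carrier (L0 M).
     (\<forall>x\<in>carrier E. \<forall>y\<in>carrier E. \<mu> (x \<oplus>\<^bsub>E\<^esub> y) = \<mu> x \<oplus>\<^bsub>L0 M\<^esub> \<mu> y) \<and>
     (\<forall>\<eta>\<in>carrier (L0 M). \<forall>x\<in>carrier E. \<mu> (\<eta> \<odot>\<^bsub>E\<^esub> x) = \<eta> \<otimes>\<^bsub>L0 M\<^esub> \<mu> x) \<and>
     continuous_map (seminorm_topology M E {p}) (L0_topology M) \<mu>}"

definition weak_topology ::
    "'w measure \<Rightarrow> (('w \<Rightarrow> real) set, 'e, 'm) module_scheme \<Rightarrow> ('e \<Rightarrow> ('w \<Rightarrow> real) set) \<Rightarrow>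
     'e topology" where
  "weak_topology M E p =
     seminorm_topology M E ((\<lambda>\<mu> x. L0_abs M (\<mu> x)) ` L0_dual M E p)"

section \<open>Nets\<close>

definition directed_set :: "'g set \<Rightarrow> ('g \<Rightarrow> 'g \<Rightarrow> bool) \<Rightarrow> bool" where
  "directed_set G leq \<longleftrightarrow> G \<noteq> {} \<and> (\<forall>a\<in>G. leq a a) \<and>
     (\<forall>a\<in>G. \<forall>b\<in>G. \<forall>c\<in>G. leq a b \<longrightarrow> leq b c \<longrightarrow> leq a c) \<and>
     (\<forall>a\<in>G. \<forall>b\<in>G. \<exists>c\<in>G. leq a c \<and> leq b c)"

text \<open>The filter of tails, so that \<open>limitin T x l (net_filter G leq)\<close> is convergence of the net
  \<open>x\<close> to \<open>l\<close>; cf. \<open>eventually_net_filter\<close> below.\<close>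

definition net_filter :: "'g set \<Rightarrow> ('g \<Rightarrow> 'g \<Rightarrow> bool) \<Rightarrow> 'g filter" where
  "net_filter G leq = (INF a\<in>G. principal {b\<in>G. leq a b})"

section \<open>Concatenations and stability\<close>

text \<open>Elements of the measure algebra are given by representing events. So disjointness holds up to
  a null event, and the supremum, i.e. the class of the countable union, is the class of the
  whole space. Everything below depends on the events only through their classes.\<close>

definition partition_seq :: "'w measure \<Rightarrow> (nat \<Rightarrow> 'w set) \<Rightarrow> bool" where
  "partition_seq M A \<longleftrightarrow> range A \<subseteq> sets M \<and>
     (\<forall>i j. i \<noteq> j \<longrightarrow> A i \<inter> A j \<in> null_sets M) \<and>
     space M - (\<Union>k. A k) \<in> null_sets M"

definition is_concatenation ::
    "'w measure \<Rightarrow> (('w \<Rightarrow> real) set, 'e, 'm) module_scheme \<Rightarrow> (nat \<Rightarrow> 'e) \<Rightarrow>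
     (nat \<Rightarrow> 'w set) \<Rightarrow> 'e \<Rightarrow> bool" where
  "is_concatenation M E x A z \<longleftrightarrow> z \<in> carrier E \<and>
     (\<forall>k. L0_indicator M (A k) \<odot>\<^bsub>E\<^esub> z = L0_indicator M (A k) \<odot>\<^bsub>E\<^esub> x k)"

definition stable_hull ::
    "'w measure \<Rightarrow> (('w \<Rightarrow> real) set, 'e, 'm) module_scheme \<Rightarrow> 'e set \<Rightarrow> 'e set" where
  "stable_hull M E K = {z \<in> carrier E. \<exists>x A. range x \<subseteq> K \<and> partition_seq M A \<and>
     is_concatenation M E x A z}"

definition relatively_stable ::
    "'w measure \<Rightarrow> (('w \<Rightarrow> real) set, 'e, 'm) module_scheme \<Rightarrow> 'e set \<Rightarrow> bool" where
  "relatively_stable M E K \<longleftrightarrow> K \<subseteq> carrier E \<and>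
     (\<forall>x A z. range x \<subseteq> K \<and> partition_seq M A \<and> is_concatenation M E x A z \<longrightarrow> z \<in> K)"

definition sum_preserves_stability ::
    "'w measure \<Rightarrow> (('w \<Rightarrow> real) set, 'e, 'm) module_scheme \<Rightarrow> bool" where
  "sum_preserves_stability M E \<longleftrightarrow>
     (\<forall>K L. relatively_stable M E K \<and> relatively_stable M E L \<longrightarrow>
        relatively_stable M E (K <+>\<^bsub>E\<^esub> L))"

definition L0_convex_hull ::
    "'w measure \<Rightarrow> (('w \<Rightarrow> real) set, 'e, 'm) module_scheme \<Rightarrow> 'e set \<Rightarrow> 'e set" where
  "L0_convex_hull M E S = {(\<Oplus>\<^bsub>E\<^esub>i\<in>I. \<eta> i \<odot>\<^bsub>E\<^esub> x i) | (I :: nat set) \<eta> x.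
     finite I \<and> x \<in> I \<rightarrow> S \<and> \<eta> \<in> I \<rightarrow> L0_nonneg M \<and>
     (\<Oplus>\<^bsub>L0 M\<^esub>i\<in>I. \<eta> i) = \<one>\<^bsub>L0 M\<^esub>}"

section \<open>Well-definedness\<close>

lemma equiv_ae_eq_rel: "equiv (borel_measurable M) (ae_eq_rel M)"
proof (rule equivI)
  show "ae_eq_rel M \<subseteq> borel_measurable M \<times> borel_measurable M"
    by (auto simp: ae_eq_rel_def)
  show "refl_on (borel_measurable M) (ae_eq_rel M)"
    by (auto simp: ae_eq_rel_def refl_on_def)
  show "sym (ae_eq_rel M)"
    by (auto simp: ae_eq_rel_def sym_def elim: AE_mp)
  show "trans (ae_eq_rel M)"
  proof (rule transI)
    fix f g h assume a: "(f, g) \<in> ae_eq_rel M" "(g, h) \<in> ae_eq_rel M"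
    then have "AE w in M. f w = g w" "AE w in M. g w = h w"
      by (auto simp: ae_eq_rel_def)
    then have "AE w in M. f w = h w" by eventually_elim simp
    with a show "(f, h) \<in> ae_eq_rel M" by (auto simp: ae_eq_rel_def)
  qed
qed

lemma mem_L0_class:
  "g \<in> L0_class M f \<longleftrightarrow> f \<in> borel_measurable M \<and> g \<in> borel_measurable M \<and> (AE w in M. f w = g w)"
  by (auto simp: L0_class_def ae_eq_rel_def)

lemma L0_class_eq_iff:
  assumes "f \<in> borel_measurable M" "g \<in> borel_measurable M"
  shows "L0_class M f = L0_class M g \<longleftrightarrow> (AE w in M. f w = g w)"
  using eq_equiv_class_iff[OF equiv_ae_eq_rel assms] assms
  by (auto simp: L0_class_def ae_eq_rel_def)

lemma carrier_L0: "carrier (L0 M) = L0_class M ` borel_measurable M"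
  by (auto simp: L0_def quotient_def L0_class_def)

lemma L0_class_in_carrier: "f \<in> borel_measurable M \<Longrightarrow> L0_class M f \<in> carrier (L0 M)"
  by (simp add: carrier_L0)

lemma L0_zero: "\<zero>\<^bsub>L0 M\<^esub> = L0_class M (\<lambda>_. 0)"
  and L0_one: "\<one>\<^bsub>L0 M\<^esub> = L0_class M (\<lambda>_. 1)"
  by (simp_all add: L0_def)

lemma UN_L0_class2:
  fixes F :: "real \<Rightarrow> real \<Rightarrow> real"
  assumes f: "f \<in> borel_measurable M" and g: "g \<in> borel_measurable M"
    and F: "\<And>u v. u \<in> borel_measurable M \<Longrightarrow> v \<in> borel_measurable M \<Longrightarrow>
      (\<lambda>w. F (u w) (v w)) \<in> borel_measurable M"
  shows "(\<Union>u\<in>L0_class M f. \<Union>v\<in>L0_class M g. L0_class M (\<lambda>w. F (u w) (v w))) =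
    L0_class M (\<lambda>w. F (f w) (g w))"
proof -
  have "L0_class M (\<lambda>w. F (u w) (v w)) = L0_class M (\<lambda>w. F (f w) (g w))"
    if "u \<in> L0_class M f" "v \<in> L0_class M g" for u v
  proof -
    from that have *: "u \<in> borel_measurable M" "v \<in> borel_measurable M"
        "AE w in M. f w = u w" "AE w in M. g w = v w"
      by (auto simp: mem_L0_class)
    from *(3,4) have "AE w in M. F (u w) (v w) = F (f w) (g w)" by eventually_elim simp
    then show ?thesis by (subst L0_class_eq_iff) (auto intro: F * f g)
  qed
  moreover have "f \<in> L0_class M f" "g \<in> L0_class M g" by (auto simp: mem_L0_class f g)
  ultimately show ?thesis by blast
qed

lemma L0_add:
  "f \<in> borel_measurable M \<Longrightarrow> g \<in> borel_measurable M \<Longrightarrow>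
   L0_class M f \<oplus>\<^bsub>L0 M\<^esub> L0_class M g = L0_class M (\<lambda>w. f w + g w)"
  using UN_L0_class2[of f M g "(+)"] by (simp add: L0_def)

lemma L0_mult:
  "f \<in> borel_measurable M \<Longrightarrow> g \<in> borel_measurable M \<Longrightarrow>
   L0_class M f \<otimes>\<^bsub>L0 M\<^esub> L0_class M g = L0_class M (\<lambda>w. f w * g w)"
  using UN_L0_class2[of f M g "(*)"] by (simp add: L0_def)

lemma L0_abs_class:
  "f \<in> borel_measurable M \<Longrightarrow> L0_abs M (L0_class M f) = L0_class M (\<lambda>w. \<bar>f w\<bar>)"
  using UN_L0_class2[of f M f "\<lambda>u v. \<bar>u\<bar>"] by (auto simp: L0_abs_def mem_L0_class)

lemma L0_le_class:
  assumes "f \<in> borel_measurable M" "g \<in> borel_measurable M"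
  shows "L0_le M (L0_class M f) (L0_class M g) \<longleftrightarrow> (AE w in M. f w \<le> g w)"
proof
  assume "L0_le M (L0_class M f) (L0_class M g)"
  then obtain u v where "AE w in M. f w = u w" "AE w in M. g w = v w" "AE w in M. u w \<le> v w"
    by (auto simp: L0_le_def mem_L0_class)
  then show "AE w in M. f w \<le> g w" by eventually_elim simp
next
  assume "AE w in M. f w \<le> g w"
  moreover have "f \<in> L0_class M f" "g \<in> L0_class M g" using assms by (auto simp: mem_L0_class)
  ultimately show "L0_le M (L0_class M f) (L0_class M g)" unfolding L0_le_def by blast
qed

lemma L0_less_class:
  assumes "f \<in> borel_measurable M" "g \<in> borel_measurable M"
  shows "L0_less M (L0_class M f) (L0_class M g) \<longleftrightarrow> (AE w in M. f w < g w)"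
proof
  assume "L0_less M (L0_class M f) (L0_class M g)"
  then obtain u v where "AE w in M. f w = u w" "AE w in M. g w = v w" "AE w in M. u w < v w"
    by (auto simp: L0_less_def mem_L0_class)
  then show "AE w in M. f w < g w" by eventually_elim simp
next
  assume "AE w in M. f w < g w"
  moreover have "f \<in> L0_class M f" "g \<in> L0_class M g" using assms by (auto simp: mem_L0_class)
  ultimately show "L0_less M (L0_class M f) (L0_class M g)" unfolding L0_less_def by blast
qed

lemma L0_nonneg_iff:
  "X \<in> L0_nonneg M \<longleftrightarrow> (\<exists>f\<in>borel_measurable M. X = L0_class M f \<and> (AE w in M. 0 \<le> f w))"
  by (auto simp: L0_nonneg_def carrier_L0 L0_zero L0_le_class)

lemma L0_pos_iff:
  "X \<in> L0_pos M \<longleftrightarrow> (\<exists>f\<in>borel_measurable M. X = L0_class M f \<and> (AE w in M. 0 < f w))"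
  by (auto simp: L0_pos_def carrier_L0 L0_zero L0_less_class)

lemma cring_L0: "cring (L0 M)"
proof (rule cringI)
  show "abelian_group (L0 M)"
  proof (rule abelian_groupI)
    fix X assume "X \<in> carrier (L0 M)"
    then obtain f where f: "f \<in> borel_measurable M" "X = L0_class M f"
      by (auto simp: carrier_L0)
    have "L0_class M (\<lambda>w. - f w) \<oplus>\<^bsub>L0 M\<^esub> X = \<zero>\<^bsub>L0 M\<^esub>"
      using f by (simp add: L0_add L0_zero)
    with f show "\<exists>Y\<in>carrier (L0 M). Y \<oplus>\<^bsub>L0 M\<^esub> X = \<zero>\<^bsub>L0 M\<^esub>"
      by (intro bexI[of _ "L0_class M (\<lambda>w. - f w)"] L0_class_in_carrier) auto
  qed (auto simp: carrier_L0 L0_add L0_zero algebra_simps)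
  show "comm_monoid (L0 M)"
    by (rule comm_monoidI) (auto simp: carrier_L0 L0_mult L0_one algebra_simps)
qed (auto simp: carrier_L0 L0_mult L0_add algebra_simps)

lemma L0_le_trans:
  assumes "X \<in> carrier (L0 M)" "Y \<in> carrier (L0 M)" "Z \<in> carrier (L0 M)"
    "L0_le M X Y" "L0_le M Y Z"
  shows "L0_le M X Z"
proof -
  obtain f g h where *: "f \<in> borel_measurable M" "X = L0_class M f"
      "g \<in> borel_measurable M" "Y = L0_class M g" "h \<in> borel_measurable M" "Z = L0_class M h"
    using assms(1-3) by (auto simp: carrier_L0)
  with assms(4,5) have "AE w in M. f w \<le> g w" "AE w in M. g w \<le> h w" by (auto simp: L0_le_class)
  then have "AE w in M. f w \<le> h w" by eventually_elim simp
  with * show ?thesis by (simp add: L0_le_class)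
qed

lemma L0_le_antisym:
  assumes "X \<in> carrier (L0 M)" "Y \<in> carrier (L0 M)" "L0_le M X Y" "L0_le M Y X"
  shows "X = Y"
proof -
  obtain f g where *: "f \<in> borel_measurable M" "X = L0_class M f"
      "g \<in> borel_measurable M" "Y = L0_class M g"
    using assms(1,2) by (auto simp: carrier_L0)
  with assms(3,4) have "AE w in M. f w \<le> g w" "AE w in M. g w \<le> f w" by (auto simp: L0_le_class)
  then have "AE w in M. f w = g w" by eventually_elim simp
  with * show ?thesis by (simp add: L0_class_eq_iff)
qed

lemma is_L0_esssup_unique: "is_L0_esssup M S s \<Longrightarrow> is_L0_esssup M S t \<Longrightarrow> s = t"
  by (rule L0_le_antisym[of _ M]) (auto simp: is_L0_esssup_def L0_nonneg_def)

lemma is_L0_esssup_exists: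
  assumes "finite S" "S \<subseteq> L0_nonneg M"
  shows "\<exists>s. is_L0_esssup M S s"
  using assms
proof (induction S rule: finite_induct)
  case empty
  have "is_L0_esssup M {} (\<zero>\<^bsub>L0 M\<^esub>)"
    by (auto simp: is_L0_esssup_def L0_nonneg_def L0_zero L0_le_class L0_class_in_carrier)
  then show ?case ..
next
  case (insert X S)
  then obtain s where s: "is_L0_esssup M S s" by auto
  obtain f where f: "f \<in> borel_measurable M" "s = L0_class M f" "AE w in M. 0 \<le> f w"
    using s by (auto simp: is_L0_esssup_def L0_nonneg_iff)
  obtain g where g: "g \<in> borel_measurable M" "X = L0_class M g" "AE w in M. 0 \<le> g w"
    using insert.prems by (auto simp: L0_nonneg_iff)
  let ?m = "L0_class M (\<lambda>w. max (f w) (g w))"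
  have m: "(\<lambda>w. max (f w) (g w)) \<in> borel_measurable M" using f g by auto
  have le: "L0_le M s ?m" "L0_le M X ?m"
    using f g m by (auto simp: L0_le_class)
  have "is_L0_esssup M (insert X S) ?m"
    unfolding is_L0_esssup_def
  proof (intro conjI ballI impI)
    show "?m \<in> L0_nonneg M"
      unfolding L0_nonneg_iff using m f(3) by (intro bexI[OF _ m]) auto
  next
    fix Y assume Y: "Y \<in> insert X S"
    show "L0_le M Y ?m"
    proof (cases "Y = X")
      case False
      with Y insert.prems s have "Y \<in> carrier (L0 M)" "L0_le M Y s"
        by (auto simp: is_L0_esssup_def L0_nonneg_def)
      then show ?thesis
        using L0_le_trans[of Y M s ?m] le f m by (simp add: L0_class_in_carrier)
    qed (simp add: le)
  next
    fix t assume t: "t \<in> L0_nonneg M" "\<forall>Y\<in>insert X S. L0_le M Y t"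
    then obtain h where h: "h \<in> borel_measurable M" "t = L0_class M h"
      by (auto simp: L0_nonneg_iff)
    from s t have "L0_le M s t" "L0_le M X t" by (auto simp: is_L0_esssup_def)
    with f g h have "AE w in M. f w \<le> h w" "AE w in M. g w \<le> h w" by (auto simp: L0_le_class)
    then have "AE w in M. max (f w) (g w) \<le> h w" by eventually_elim simp
    with h m show "L0_le M ?m t" by (simp add: L0_le_class)
  qed
  then show ?case ..
qed

lemma L0_esssup_le_iff:
  assumes "finite S" "S \<subseteq> L0_nonneg M" "t \<in> L0_nonneg M"
  shows "L0_le M (L0_esssup M S) t \<longleftrightarrow> (\<forall>X\<in>S. L0_le M X t)"
proof -
  obtain s where s: "is_L0_esssup M S s" using is_L0_esssup_exists[OF assms(1,2)] ..
  then have "L0_esssup M S = s"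
    unfolding L0_esssup_def by (intro the_equality is_L0_esssup_unique)
  with s assms(2,3) show ?thesis
    by (auto simp: is_L0_esssup_def L0_nonneg_def intro: L0_le_trans[of _ M s])
qed

lemma L0_pos_min:
  assumes "a \<in> L0_pos M" "b \<in> L0_pos M"
  obtains c where "c \<in> L0_pos M" "L0_le M c a" "L0_le M c b"
proof -
  obtain f g where fg: "f \<in> borel_measurable M" "a = L0_class M f" "AE w in M. 0 < f w"
      "g \<in> borel_measurable M" "b = L0_class M g" "AE w in M. 0 < g w"
    using assms by (auto simp: L0_pos_iff)
  have m: "(\<lambda>w. min (f w) (g w)) \<in> borel_measurable M" using fg by auto
  from fg(3,6) have "AE w in M. 0 < min (f w) (g w)" by eventually_elim simp
  with fg m show thesis
    by (intro that[of "L0_class M (\<lambda>w. min (f w) (g w))"]) (auto simp: L0_pos_iff L0_le_class)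
qed

lemma L0_pos_nonneg: "a \<in> L0_pos M \<Longrightarrow> a \<in> L0_nonneg M"
  by (force simp: L0_pos_iff L0_nonneg_iff elim: AE_mp)

lemma L0_pos_carrier: "a \<in> L0_pos M \<Longrightarrow> a \<in> carrier (L0 M)"
  by (auto simp: L0_pos_def)

lemma L0_nonneg_carrier: "a \<in> L0_nonneg M \<Longrightarrow> a \<in> carrier (L0 M)"
  by (auto simp: L0_nonneg_def)

lemma L0_one_pos: "\<one>\<^bsub>L0 M\<^esub> \<in> L0_pos M"
  by (auto simp: L0_pos_iff L0_one)

lemma L0_abs_nonneg: "X \<in> carrier (L0 M) \<Longrightarrow> L0_abs M X \<in> L0_nonneg M"
  by (auto simp: carrier_L0 L0_nonneg_iff L0_abs_class)

lemma openin_L0_topology: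
  "openin (L0_topology M) U \<longleftrightarrow> U \<subseteq> carrier (L0 M) \<and>
     (\<forall>\<eta>\<in>U. \<exists>\<epsilon>\<in>L0_pos M. (\<lambda>\<xi>. \<eta> \<oplus>\<^bsub>L0 M\<^esub> \<xi>) ` L0_ball M \<epsilon> \<subseteq> U)"
proof -
  have mono: "L0_ball M c \<subseteq> L0_ball M a" if "c \<in> L0_pos M" "a \<in> L0_pos M" "L0_le M c a" for a c
    using that
    by (auto simp: L0_ball_def L0_pos_carrier L0_nonneg_carrier L0_abs_nonneg
        intro: L0_le_trans[of _ M c])
  have "istopology (\<lambda>U. U \<subseteq> carrier (L0 M) \<and>
     (\<forall>\<eta>\<in>U. \<exists>\<epsilon>\<in>L0_pos M. (\<lambda>\<xi>. \<eta> \<oplus>\<^bsub>L0 M\<^esub> \<xi>) ` L0_ball M \<epsilon> \<subseteq> U))"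
    unfolding istopology_def
  proof (intro conjI allI impI ballI)
    fix S T \<eta>
    assume S: "S \<subseteq> carrier (L0 M) \<and>
        (\<forall>\<eta>\<in>S. \<exists>\<epsilon>\<in>L0_pos M. (\<lambda>\<xi>. \<eta> \<oplus>\<^bsub>L0 M\<^esub> \<xi>) ` L0_ball M \<epsilon> \<subseteq> S)"
      and T: "T \<subseteq> carrier (L0 M) \<and>
        (\<forall>\<eta>\<in>T. \<exists>\<epsilon>\<in>L0_pos M. (\<lambda>\<xi>. \<eta> \<oplus>\<^bsub>L0 M\<^esub> \<xi>) ` L0_ball M \<epsilon> \<subseteq> T)"
      and \<eta>: "\<eta> \<in> S \<inter> T"
    obtain a where a: "a \<in> L0_pos M" "(\<lambda>\<xi>. \<eta> \<oplus>\<^bsub>L0 M\<^esub> \<xi>) ` L0_ball M a \<subseteq> S"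
      using S \<eta> by blast
    obtain b where b: "b \<in> L0_pos M" "(\<lambda>\<xi>. \<eta> \<oplus>\<^bsub>L0 M\<^esub> \<xi>) ` L0_ball M b \<subseteq> T"
      using T \<eta> by blast
    obtain c where "c \<in> L0_pos M" "L0_le M c a" "L0_le M c b"
      using L0_pos_min[OF a(1) b(1)] .
    with mono[of c a] mono[of c b] a b
    show "\<exists>\<epsilon>\<in>L0_pos M. (\<lambda>\<xi>. \<eta> \<oplus>\<^bsub>L0 M\<^esub> \<xi>) ` L0_ball M \<epsilon> \<subseteq> S \<inter> T"
      by (intro bexI[of _ c]) blast+
  next
    fix \<K> \<eta>
    assume K: "\<forall>K\<in>\<K>. K \<subseteq> carrier (L0 M) \<and>
        (\<forall>\<eta>\<in>K. \<exists>\<epsilon>\<in>L0_pos M. (\<lambda>\<xi>. \<eta> \<oplus>\<^bsub>L0 M\<^esub> \<xi>) ` L0_ball M \<epsilon> \<subseteq> K)"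
      and "\<eta> \<in> \<Union>\<K>"
    then obtain K where "K \<in> \<K>" "\<eta> \<in> K" by blast
    with K show "\<exists>\<epsilon>\<in>L0_pos M. (\<lambda>\<xi>. \<eta> \<oplus>\<^bsub>L0 M\<^esub> \<xi>) ` L0_ball M \<epsilon> \<subseteq> \<Union>\<K>"
      by (meson Union_upper order_trans)
  qed blast+
  then show ?thesis by (simp add: L0_topology_def)
qed

lemma seminorm_nbhd_eq:
  assumes "finite F" "\<forall>p\<in>F. p \<in> carrier E \<rightarrow> L0_nonneg M" "\<epsilon> \<in> L0_pos M"
  shows "seminorm_nbhd M E F \<epsilon> = {y \<in> carrier E. \<forall>p\<in>F. L0_le M (p y) \<epsilon>}"
proof -
  have "L0_le M (L0_esssup M ((\<lambda>p. p y) ` F)) \<epsilon> \<longleftrightarrow> (\<forall>p\<in>F. L0_le M (p y) \<epsilon>)"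
    if "y \<in> carrier E" for y
    using assms that by (subst L0_esssup_le_iff) (auto simp: L0_pos_nonneg)
  then show ?thesis by (auto simp: seminorm_nbhd_def)
qed

lemma openin_seminorm_topology:
  assumes P: "\<And>p. p \<in> P \<Longrightarrow> p \<in> carrier E \<rightarrow> L0_nonneg M"
  shows "openin (seminorm_topology M E P) U \<longleftrightarrow> U \<subseteq> carrier E \<and>
     (\<forall>x\<in>U. \<exists>F \<epsilon>. finite F \<and> F \<subseteq> P \<and> \<epsilon> \<in> L0_pos M \<and>
        (\<lambda>y. x \<oplus>\<^bsub>E\<^esub> y) ` seminorm_nbhd M E F \<epsilon> \<subseteq> U)"
proof -
  have mono: "seminorm_nbhd M E H c \<subseteq> seminorm_nbhd M E F a"
    if "finite H" "F \<subseteq> H" "H \<subseteq> P" "c \<in> L0_pos M" "a \<in> L0_pos M" "L0_le M c a" for F H a c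
  proof -
    have fin: "finite F" using that finite_subset by blast
    have "L0_le M (p y) a" if "p \<in> F" "y \<in> carrier E" "L0_le M (p y) c" for p y
    proof -
      have "p y \<in> carrier (L0 M)"
        using P[of p] that \<open>F \<subseteq> H\<close> \<open>H \<subseteq> P\<close> by (auto intro: L0_nonneg_carrier)
      then show ?thesis
        using that(3) \<open>c \<in> L0_pos M\<close> \<open>a \<in> L0_pos M\<close> \<open>L0_le M c a\<close>
        by (auto intro: L0_le_trans[of _ M c] L0_pos_carrier)
    qed
    moreover have "\<forall>p\<in>H. p \<in> carrier E \<rightarrow> L0_nonneg M" "\<forall>p\<in>F. p \<in> carrier E \<rightarrow> L0_nonneg M"
      using P that by blast+
    ultimately show ?thesis
      using that fin by (auto simp: seminorm_nbhd_eq)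
  qed
  have "istopology (\<lambda>U. U \<subseteq> carrier E \<and>
     (\<forall>x\<in>U. \<exists>F \<epsilon>. finite F \<and> F \<subseteq> P \<and> \<epsilon> \<in> L0_pos M \<and>
        (\<lambda>y. x \<oplus>\<^bsub>E\<^esub> y) ` seminorm_nbhd M E F \<epsilon> \<subseteq> U))" (is "istopology ?O")
    unfolding istopology_def
  proof (intro conjI allI impI ballI)
    fix S T x
    assume S: "?O S" and T: "?O T" and x: "x \<in> S \<inter> T"
    obtain F a where F: "finite F" "F \<subseteq> P" "a \<in> L0_pos M"
        "(\<lambda>y. x \<oplus>\<^bsub>E\<^esub> y) ` seminorm_nbhd M E F a \<subseteq> S"
      using S x by blast
    obtain H b where H: "finite H" "H \<subseteq> P" "b \<in> L0_pos M"
        "(\<lambda>y. x \<oplus>\<^bsub>E\<^esub> y) ` seminorm_nbhd M E H b \<subseteq> T"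
      using T x by blast
    obtain c where c: "c \<in> L0_pos M" "L0_le M c a" "L0_le M c b"
      using L0_pos_min[OF F(3) H(3)] .
    have "seminorm_nbhd M E (F \<union> H) c \<subseteq> seminorm_nbhd M E F a"
      and "seminorm_nbhd M E (F \<union> H) c \<subseteq> seminorm_nbhd M E H b"
      by (rule mono; use F H c in simp)+
    then have "(\<lambda>y. x \<oplus>\<^bsub>E\<^esub> y) ` seminorm_nbhd M E (F \<union> H) c \<subseteq> S \<inter> T"
      using F(4) H(4) by blast
    with F H c show "\<exists>F \<epsilon>. finite F \<and> F \<subseteq> P \<and> \<epsilon> \<in> L0_pos M \<and>
        (\<lambda>y. x \<oplus>\<^bsub>E\<^esub> y) ` seminorm_nbhd M E F \<epsilon> \<subseteq> S \<inter> T"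
      by (intro exI[of _ "F \<union> H"] exI[of _ c]) auto
  next
    fix \<K> x
    assume K: "\<forall>K\<in>\<K>. ?O K" and "x \<in> \<Union>\<K>"
    then obtain K where "K \<in> \<K>" "x \<in> K" by blast
    with K show "\<exists>F \<epsilon>. finite F \<and> F \<subseteq> P \<and> \<epsilon> \<in> L0_pos M \<and>
        (\<lambda>y. x \<oplus>\<^bsub>E\<^esub> y) ` seminorm_nbhd M E F \<epsilon> \<subseteq> \<Union>\<K>"
      by (meson Union_upper order_trans)
  qed blast+
  then show ?thesis by (simp add: seminorm_topology_def)
qed

lemma eventually_net_filter:
  assumes "directed_set G leq"
  shows "eventually Q (net_filter G leq) \<longleftrightarrow> (\<exists>a\<in>G. \<forall>b\<in>G. leq a b \<longrightarrow> Q b)"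
proof -
  have "eventually Q (net_filter G leq) \<longleftrightarrow>
      (\<exists>a\<in>G. eventually Q (principal {b\<in>G. leq a b}))"
    unfolding net_filter_def
  proof (rule eventually_INF_base)
    show "G \<noteq> {}" using assms by (simp add: directed_set_def)
  next
    fix a b assume ab: "a \<in> G" "b \<in> G"
    then obtain c where c: "c \<in> G" "leq a c" "leq b c"
      using assms unfolding directed_set_def by blast
    then have "{d \<in> G. leq c d} \<subseteq> {d \<in> G. leq a d} \<inter> {d \<in> G. leq b d}"
      using assms ab unfolding directed_set_def by blast
    with c show "\<exists>c\<in>G. principal {d \<in> G. leq c d} \<le>
        inf (principal {d \<in> G. leq a d}) (principal {d \<in> G. leq b d})"
      by (intro bexI[of _ c]) (simp_all only: inf_principal principal_le_iff)
  qed
  then show ?thesis by (auto simp: eventually_principal)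
qed

end

theory Submission
  imports Defs
begin

text \<open>
  This is Mazur's lemma over the ring \<open>L\<^sup>0\<close>. Let \<open>C\<close> be the convex hull of the net and let \<open>r\<close> be the
  essential infimum of \<open>\<parallel>l - c\<parallel>\<close> over \<open>c \<in> C\<close>. Convex combinations with weights \<open>1\<^sub>A\<close> and \<open>1 - 1\<^sub>A\<close>
  make this family directed downwards, so \<open>r\<close> is the pointwise infimum of countably many distances
  \<open>\<parallel>l - c\<^sub>n\<parallel>\<close> (lemma \<open>directed_essential_infimum\<close>). Everything rests on two facts about \<open>r\<close>.

  Weak convergence forces \<open>r < \<epsilon>\<close> almost surely. The convex set \<open>l - C\<close> has norm at least
  \<open>u = \<epsilon> 1\<^bsub>{r \<ge> \<epsilon>}\<^esub>\<close>, so a Hahn--Banach argument (lemma \<open>separate_convex_set_from_zero\<close>) gives a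
  continuous linear functional \<open>\<phi>\<close> with \<open>\<phi>(l - c) \<ge> u\<close> for all \<open>c \<in> C\<close>. But some member of the
  net satisfies \<open>|\<phi>(l - x\<^sub>\<gamma>)| < \<epsilon>/2\<close>, hence \<open>u < \<epsilon>/2\<close>, and the event \<open>{r \<ge> \<epsilon>}\<close> is null.

  If \<open>r < \<epsilon>\<close>, then \<open>\<Omega>\<close> is partitioned into events \<open>A\<^sub>n\<close> on which \<open>\<parallel>l - c\<^sub>n\<parallel> \<le> \<epsilon>\<close>. The natural
  approximation, the concatenation of the \<open>c\<^sub>n\<close> along the \<open>A\<^sub>n\<close>, may fail to exist in the module.
  However \<open>l\<close> itself is a concatenation of the elements \<open>c\<^sub>n + 1\<^bsub>A\<^sub>n\<^esub> (l - c\<^sub>n)\<close>, which lie in the sum of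
  the stable hull of \<open>C\<close> and the \<open>\<epsilon>\<close>-ball. Both summands are relatively stable, so by hypothesis
  the sum is, and \<open>l\<close> belongs to it (lemma \<open>glue_approximations\<close>).

  For the Hahn--Banach theorem, sublinear functionals are replaced by their epigraphs, which are
  \<open>L\<^sup>0\<close>-convex cones of pairs \<open>(x, f)\<close> of a vector and a random variable. Zorn's lemma then only
  needs unions of chains of sets, and a maximal cone is the epigraph of a linear functional.
  Throughout, an element of \<open>L\<^sup>0\<close> is handled through a measurable function representing it, so that
  inequalities become pointwise inequalities outside a null set.
\<close>

section \<open>Essential infima of directed families\<close>

text \<open>
  Replacing \<open>f\<close> by \<open>arctan f\<close> makes every member integrable, so a sequence \<open>F\<close> in the family can be
  chosen along which the expectation tends to its infimum. If the pointwise infimum \<open>c\<close> of \<open>F\<close>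
  exceeded a member \<open>f\<close> on an event of positive probability, a common lower bound of \<open>f\<close> and
  \<open>F n\<close> for large \<open>n\<close> would bring the expectation below its infimum.
\<close>

lemma (in prob_space) directed_essential_infimum:
  fixes S :: "('a \<Rightarrow> real) set"
  assumes "S \<noteq> {}" and S: "S \<subseteq> borel_measurable M"
    and directed: "\<And>f g. f \<in> S \<Longrightarrow> g \<in> S \<Longrightarrow> \<exists>h\<in>S. AE w in M. h w \<le> f w \<and> h w \<le> g w"
    and lower: "\<And>f. f \<in> S \<Longrightarrow> AE w in M. b w \<le> f w"
  obtains F :: "nat \<Rightarrow> 'a \<Rightarrow> real" and c where "range F \<subseteq> S" "c \<in> borel_measurable M"
    "AE w in M. bdd_below (range (\<lambda>n. F n w)) \<and> c w = (INF n. F n w)"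
    "\<And>f. f \<in> S \<Longrightarrow> AE w in M. c w \<le> f w"
proof -
  define J where "J f = expectation (\<lambda>w. arctan (f w))" for f
  have arctan_le: "\<bar>arctan x\<bar> \<le> pi / 2" for x
    using arctan_bounded[of x] by linarith
  have int: "integrable M (\<lambda>w. arctan (f w))" if "f \<in> borel_measurable M" for f
  proof (rule integrable_const_bound)
    show "AE w in M. norm (arctan (f w)) \<le> pi / 2"
      unfolding real_norm_def by (intro AE_I2 arctan_le)
  qed (use that in measurable)
  have J_bdd: "bdd_below (J ` S)"
  proof (rule bdd_belowI2)
    fix f assume "f \<in> S"
    then have f: "f \<in> borel_measurable M" using S by blast
    have "expectation (\<lambda>_. - (pi / 2)) \<le> J f"
      unfolding J_def
    proof (rule integral_mono[OF integrable_const int[OF f]])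
      show "- (pi / 2) \<le> arctan (f w)" for w using arctan_le[of "f w"] by linarith
    qed
    then show "- (pi / 2) \<le> J f" by (simp add: prob_space)
  qed
  have "\<exists>f\<in>S. J f < Inf (J ` S) + 1 / Suc n" for n
  proof -
    have "Inf (J ` S) < Inf (J ` S) + 1 / Suc n" by simp
    then show ?thesis using \<open>S \<noteq> {}\<close> J_bdd by (subst (asm) cINF_less_iff) auto
  qed
  then obtain F where F: "\<And>n. F n \<in> S" "\<And>n. J (F n) < Inf (J ` S) + 1 / Suc n" by metis
  then have F_meas [measurable]: "F n \<in> borel_measurable M" for n using S by blast
  define c where "c w = (INF n. F n w)" for w
  have c [measurable]: "c \<in> borel_measurable M" unfolding c_def by measurable
  have "AE w in M. \<forall>n. b w \<le> F n w" using lower F(1) by (simp add: AE_all_countable)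
  then have bdd: "AE w in M. bdd_below (range (\<lambda>n. F n w))"
    by eventually_elim (auto intro: bdd_belowI2)
  have le: "AE w in M. c w \<le> f w" if f: "f \<in> S" for f
  proof -
    have [measurable]: "f \<in> borel_measurable M" using S f by blast
    \<comment> \<open>The truncation at \<open>0\<close> makes the excess increasing in \<open>c\<close>, so that \<open>c\<close> may be replaced by
      \<open>F n\<close> when it is estimated; it suffices to show that \<open>d\<close> vanishes.\<close>
    define d where "d w = max 0 (arctan (c w) - arctan (f w))" for w
    have d [measurable]: "d \<in> borel_measurable M" unfolding d_def by measurable
    have d_int: "integrable M d"
      unfolding d_def by (intro integrable_max Bochner_Integration.integrable_diff int) auto
    have "expectation d \<le> 1 / Suc n" for n
    proof -
      obtain h where h: "h \<in> S" "AE w in M. h w \<le> F n w \<and> h w \<le> f w"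
        using directed[OF F(1) f] by blast
      have [measurable]: "h \<in> borel_measurable M" using S h by blast
      have "expectation d \<le> expectation (\<lambda>w. arctan (F n w) - arctan (h w))"
      proof (rule integral_mono_AE[OF d_int])
        show "AE w in M. d w \<le> arctan (F n w) - arctan (h w)"
          using h(2) bdd
        proof eventually_elim
          case (elim w)
          then have "c w \<le> F n w" unfolding c_def by (auto intro: cINF_lower)
          then have "arctan (c w) \<le> arctan (F n w)" "arctan (h w) \<le> arctan (F n w)"
            "arctan (h w) \<le> arctan (f w)"
            using elim by (simp_all add: arctan_le_iff)
          then show ?case unfolding d_def by linarith
        qed
      qed (simp add: int)
      also have "\<dots> = J (F n) - J h" by (simp add: J_def int)
      also have "\<dots> \<le> 1 / Suc n"
        using F(2)[of n] cINF_lower[OF J_bdd h(1)] by simp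
      finally show ?thesis .
    qed
    then have "expectation d \<le> 0"
      by (intro LIMSEQ_le_const[OF LIMSEQ_inverse_real_of_nat]) (simp add: inverse_eq_divide)
    moreover have "0 \<le> expectation d" by (rule integral_nonneg_AE) (simp add: d_def)
    ultimately have "AE w in M. d w = 0"
      using integral_nonneg_eq_0_iff_AE[OF d_int] by (simp add: d_def)
    then show ?thesis
    proof eventually_elim
      case (elim w)
      then have "arctan (c w) \<le> arctan (f w)" unfolding d_def by linarith
      then show ?case by (simp add: arctan_le_iff)
    qed
  qed
  show thesis
    using that[of F c] F(1) c bdd le by (auto simp: c_def)
qed

section \<open>Modules over random variables, through representatives\<close>

locale L0_seminormed = prob_space M + module "L0 M" E
  for M :: "'w measure" and E :: "(('w \<Rightarrow> real) set, 'e, 'm) module_scheme" (structure) +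
  fixes nrm :: "'e \<Rightarrow> ('w \<Rightarrow> real) set"
  assumes nrm: "L0_seminorm M E nrm"
begin

definition scale :: "('w \<Rightarrow> real) \<Rightarrow> 'e \<Rightarrow> 'e" (infixr "*\<^sub>E" 75) where
  "f *\<^sub>E x = L0_class M f \<odot> x"

text \<open>
  The choices for different vectors are uncoordinated, so the properties of the norm carry over only
  up to null sets that depend on the vectors and scalars involved.
\<close>

definition N :: "'e \<Rightarrow> 'w \<Rightarrow> real" where
  "N x = (SOME f. f \<in> nrm x)"

lemma scale_closed [simp, intro]:
  "f \<in> borel_measurable M \<Longrightarrow> x \<in> carrier E \<Longrightarrow> f *\<^sub>E x \<in> carrier E"
  by (simp add: scale_def L0_class_in_carrier)

lemma scale_cong_AE:
  "f \<in> borel_measurable M \<Longrightarrow> g \<in> borel_measurable M \<Longrightarrow> AE w in M. f w = g w \<Longrightarrow> f *\<^sub>E x = g *\<^sub>E x"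
  using L0_class_eq_iff[of f M g] by (simp add: scale_def)

lemma scale_add_right:
  "f \<in> borel_measurable M \<Longrightarrow> x \<in> carrier E \<Longrightarrow> y \<in> carrier E \<Longrightarrow> f *\<^sub>E (x \<oplus> y) = f *\<^sub>E x \<oplus> f *\<^sub>E y"
  by (simp add: scale_def L0_class_in_carrier smult_r_distr)

lemma scale_add_left:
  "f \<in> borel_measurable M \<Longrightarrow> g \<in> borel_measurable M \<Longrightarrow> x \<in> carrier E \<Longrightarrow>
   f *\<^sub>E x \<oplus> g *\<^sub>E x = (\<lambda>w. f w + g w) *\<^sub>E x"
  by (simp add: scale_def L0_class_in_carrier L0_add flip: smult_l_distr)

lemma scale_scale:
  "f \<in> borel_measurable M \<Longrightarrow> g \<in> borel_measurable M \<Longrightarrow> x \<in> carrier E \<Longrightarrow>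
   f *\<^sub>E (g *\<^sub>E x) = (\<lambda>w. f w * g w) *\<^sub>E x"
  by (simp add: scale_def L0_class_in_carrier L0_mult flip: smult_assoc1)

lemma scale_one [simp]: "x \<in> carrier E \<Longrightarrow> (\<lambda>_. 1) *\<^sub>E x = x"
  by (simp add: scale_def flip: L0_one)

lemma scale_zero [simp]: "x \<in> carrier E \<Longrightarrow> (\<lambda>_. 0) *\<^sub>E x = \<zero>"
  by (simp add: scale_def flip: L0_zero)

lemma minus_eq_scale: "x \<in> carrier E \<Longrightarrow> \<ominus> x = (\<lambda>_. - 1) *\<^sub>E x"
proof -
  assume x: "x \<in> carrier E"
  have "(\<lambda>_. - 1) *\<^sub>E x \<oplus> (\<lambda>_. 1) *\<^sub>E x = (\<lambda>_. 0) *\<^sub>E x"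
    using x by (subst scale_add_left) auto
  with x have "(\<lambda>_. - 1) *\<^sub>E x \<oplus> x = \<zero>" by simp
  with x show ?thesis by (intro M.minus_equality) auto
qed

lemma nrm_eq: "x \<in> carrier E \<Longrightarrow> nrm x = L0_class M (N x)"
  and N_measurable [measurable, simp]: "x \<in> carrier E \<Longrightarrow> N x \<in> borel_measurable M"
proof -
  assume "x \<in> carrier E"
  then have "nrm x \<in> L0_nonneg M" using nrm by (auto simp: L0_seminorm_def)
  then obtain f where f: "f \<in> borel_measurable M" "nrm x = L0_class M f"
    by (auto simp: L0_nonneg_iff)
  then have "f \<in> nrm x" by (simp add: mem_L0_class)
  then have "N x \<in> nrm x" unfolding N_def by (metis someI_ex)
  with f show "nrm x = L0_class M (N x)" "N x \<in> borel_measurable M"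
    by (auto simp: mem_L0_class L0_class_eq_iff)
qed

lemma N_nonneg: "x \<in> carrier E \<Longrightarrow> AE w in M. 0 \<le> N x w"
proof -
  assume x: "x \<in> carrier E"
  then have "nrm x \<in> L0_nonneg M" using nrm by (auto simp: L0_seminorm_def)
  with x show ?thesis by (simp add: nrm_eq L0_nonneg_def L0_zero L0_le_class)
qed

lemma N_scale:
  "f \<in> borel_measurable M \<Longrightarrow> x \<in> carrier E \<Longrightarrow> AE w in M. N (f *\<^sub>E x) w = \<bar>f w\<bar> * N x w"
proof -
  assume f: "f \<in> borel_measurable M" and x: "x \<in> carrier E"
  then have "nrm (f *\<^sub>E x) = L0_abs M (L0_class M f) \<otimes>\<^bsub>L0 M\<^esub> nrm x"
    using nrm by (auto simp: L0_seminorm_def scale_def L0_class_in_carrier)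
  with f x show ?thesis by (simp add: nrm_eq L0_abs_class L0_mult L0_class_eq_iff)
qed

lemma N_triangle:
  "x \<in> carrier E \<Longrightarrow> y \<in> carrier E \<Longrightarrow> AE w in M. N (x \<oplus> y) w \<le> N x w + N y w"
proof -
  assume xy: "x \<in> carrier E" "y \<in> carrier E"
  then have "L0_le M (nrm (x \<oplus> y)) (nrm x \<oplus>\<^bsub>L0 M\<^esub> nrm y)"
    using nrm by (auto simp: L0_seminorm_def)
  with xy show ?thesis by (simp add: nrm_eq L0_add L0_le_class)
qed

lemma N_zero: "AE w in M. N \<zero> w = 0"
  using N_scale[of "\<lambda>_. 0" \<zero>] by simp

lemma N_minus: "x \<in> carrier E \<Longrightarrow> AE w in M. N (\<ominus> x) w = N x w"
  using N_scale[of "\<lambda>_. - 1" x] by (simp add: minus_eq_scale)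

section \<open>Hahn--Banach separation\<close>

text \<open>
  For a functional \<open>q \<le> N\<close> that is sublinear over \<open>L\<^sup>0\<close>, the epigraph \<open>{(x, f). q x \<le> f}\<close> is a
  cone of this kind: closure under sums is subadditivity, closure under nonnegative multipliers is positive
  homogeneity, and the last condition says \<open>q 0 \<ge> 0\<close>.
\<close>

definition dominating_cone :: "('e \<times> ('w \<Rightarrow> real)) set \<Rightarrow> bool" where
  "dominating_cone K \<longleftrightarrow>
     K \<subseteq> carrier E \<times> borel_measurable M \<and>
     (\<forall>x\<in>carrier E. \<forall>f\<in>borel_measurable M. (AE w in M. N x w \<le> f w) \<longrightarrow> (x, f) \<in> K) \<and>
     (\<forall>x f y g. (x, f) \<in> K \<longrightarrow> (y, g) \<in> K \<longrightarrow> (x \<oplus> y, \<lambda>w. f w + g w) \<in> K) \<and>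
     (\<forall>t x f. t \<in> borel_measurable M \<longrightarrow> (AE w in M. 0 \<le> t w) \<longrightarrow> (x, f) \<in> K \<longrightarrow>
        (t *\<^sub>E x, \<lambda>w. t w * f w) \<in> K) \<and>
     (\<forall>f. (\<zero>, f) \<in> K \<longrightarrow> (AE w in M. 0 \<le> f w))"

lemma dominating_coneD:
  assumes "dominating_cone K"
  shows "(x, f) \<in> K \<Longrightarrow> x \<in> carrier E" "(x, f) \<in> K \<Longrightarrow> f \<in> borel_measurable M"
    and "x \<in> carrier E \<Longrightarrow> f \<in> borel_measurable M \<Longrightarrow> AE w in M. N x w \<le> f w \<Longrightarrow> (x, f) \<in> K"
    and "(x, f) \<in> K \<Longrightarrow> (y, g) \<in> K \<Longrightarrow> (x \<oplus> y, \<lambda>w. f w + g w) \<in> K"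
    and "t \<in> borel_measurable M \<Longrightarrow> AE w in M. 0 \<le> t w \<Longrightarrow> (x, f) \<in> K \<Longrightarrow>
      (t *\<^sub>E x, \<lambda>w. t w * f w) \<in> K"
    and "(\<zero>, f) \<in> K \<Longrightarrow> AE w in M. 0 \<le> f w"
  using assms unfolding dominating_cone_def by blast+

lemma maximal_dominating_cone:
  assumes K: "dominating_cone K"
  obtains L where "dominating_cone L" "K \<subseteq> L"
    "\<And>L'. dominating_cone L' \<Longrightarrow> L \<subseteq> L' \<Longrightarrow> L' = L"
proof -
  define \<A> where "\<A> = {L. dominating_cone L \<and> K \<subseteq> L}"
  have "\<exists>L\<in>\<A>. \<forall>L'\<in>\<A>. L \<subseteq> L' \<longrightarrow> L' = L"
  proof (rule subset_Zorn_nonempty)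
    show "\<A> \<noteq> {}" using K by (auto simp: \<A>_def)
  next
    fix C assume "C \<noteq> {}" and chain: "subset.chain \<A> C"
    then have C: "\<And>L. L \<in> C \<Longrightarrow> dominating_cone L" "\<And>L. L \<in> C \<Longrightarrow> K \<subseteq> L"
      by (auto simp: subset_chain_def \<A>_def)
    note D = dominating_coneD[OF C(1)]
    have "dominating_cone (\<Union>C)"
      unfolding dominating_cone_def
    proof (intro conjI allI impI ballI)
      fix x f y g assume "(x, f) \<in> \<Union>C" "(y, g) \<in> \<Union>C"
      then obtain L where "L \<in> C" "(x, f) \<in> L" "(y, g) \<in> L"
        using chain unfolding subset_chain_def by blast
      then show "(x \<oplus> y, \<lambda>w. f w + g w) \<in> \<Union>C" using D(4) by blast
    next
      show "\<Union>C \<subseteq> carrier E \<times> borel_measurable M" using D(1,2) by auto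
    next
      fix x f assume "x \<in> carrier E" "f \<in> borel_measurable M" "AE w in M. N x w \<le> f w"
      then show "(x, f) \<in> \<Union>C" using D(3) \<open>C \<noteq> {}\<close> by blast
    next
      fix t :: "'w \<Rightarrow> real" and x f assume "t \<in> borel_measurable M" "AE w in M. 0 \<le> t w" "(x, f) \<in> \<Union>C"
      then show "(t *\<^sub>E x, \<lambda>w. t w * f w) \<in> \<Union>C" using D(5) by blast
    next
      fix f assume "(\<zero>, f) \<in> \<Union>C"
      then show "AE w in M. 0 \<le> f w" using D(6) by blast
    qed
    then show "\<Union>C \<in> \<A>" using C(2) \<open>C \<noteq> {}\<close> by (auto simp: \<A>_def)
  qed
  then obtain L where L: "dominating_cone L" "K \<subseteq> L" "\<forall>L'\<in>\<A>. L \<subseteq> L' \<longrightarrow> L' = L"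
    unfolding \<A>_def by blast
  show thesis
  proof (rule that[OF L(1,2)])
    fix L' assume "dominating_cone L'" "L \<subseteq> L'"
    with L show "L' = L" unfolding \<A>_def by blast
  qed
qed

text \<open>
  Cones are local: multiplying two members by complementary indicators and adding them pastes them
  together along an event. This replaces case distinctions on the sign of a random scalar.
\<close>

lemma dominating_cone_patch:
  assumes K: "dominating_cone K" and a [simp]: "a \<in> carrier E"
    and u [measurable]: "u \<in> borel_measurable M" and v [measurable]: "v \<in> borel_measurable M"
    and uf: "(u *\<^sub>E a, f) \<in> K" and vg: "(v *\<^sub>E a, g) \<in> K" and P [measurable]: "Measurable.pred M P"
  shows "((\<lambda>w. if P w then u w else v w) *\<^sub>E a, \<lambda>w. if P w then f w else g w) \<in> K"
proof -
  note D = dominating_coneD[OF K]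
  define p q where "p w = (if P w then 1 else 0 :: real)" and "q w = (if P w then 0 else 1 :: real)" for w
  have pq [measurable]: "p \<in> borel_measurable M" "q \<in> borel_measurable M"
    unfolding p_def q_def by measurable
  have "(p *\<^sub>E u *\<^sub>E a, \<lambda>w. p w * f w) \<in> K" "(q *\<^sub>E v *\<^sub>E a, \<lambda>w. q w * g w) \<in> K"
    by (rule D(5)[OF pq(1) _ uf] D(5)[OF pq(2) _ vg], simp add: p_def q_def)+
  from D(4)[OF this]
  have "(p *\<^sub>E u *\<^sub>E a \<oplus> q *\<^sub>E v *\<^sub>E a, \<lambda>w. p w * f w + q w * g w) \<in> K" .
  moreover have "p *\<^sub>E u *\<^sub>E a \<oplus> q *\<^sub>E v *\<^sub>E a = (\<lambda>w. p w * u w + q w * v w) *\<^sub>E a"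
    using scale_add_left[of "\<lambda>w. p w * u w" "\<lambda>w. q w * v w" a] by (simp add: scale_scale)
  moreover have "(\<lambda>w. p w * u w + q w * v w) = (\<lambda>w. if P w then u w else v w)"
    "(\<lambda>w. p w * f w + q w * g w) = (\<lambda>w. if P w then f w else g w)"
    by (auto simp: p_def q_def)
  ultimately show ?thesis by simp
qed

text \<open>
  If \<open>(a, f)\<close> and \<open>(- a, g)\<close> are in the cone, then so is \<open>(0, f + g)\<close>, whence \<open>- g \<le> f\<close>. The order
  completeness of \<open>L\<^sup>0\<close> thus provides an element \<open>c\<close> in between: the value at \<open>a\<close> that an extension may
  have.
\<close>

lemma dominating_cone_value:
  assumes K: "dominating_cone K" and a [simp]: "a \<in> carrier E"
  obtains c where "c \<in> borel_measurable M"
    "\<And>f. (a, f) \<in> K \<Longrightarrow> AE w in M. c w \<le> f w"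
    "\<And>f. (\<ominus> a, f) \<in> K \<Longrightarrow> AE w in M. - f w \<le> c w"
proof -
  note D = dominating_coneD[OF K]
  define S where "S = {f. (a, f) \<in> K}"
  have lower: "AE w in M. - g w \<le> f w" if "f \<in> S" "(\<ominus> a, g) \<in> K" for f g
  proof -
    have "(\<zero>, \<lambda>w. f w + g w) \<in> K" using D(4)[of a f "\<ominus> a" g] that by (simp add: S_def M.r_neg)
    from D(6)[OF this] show ?thesis by eventually_elim simp
  qed
  have Na: "N a \<in> S" by (auto simp: S_def intro: D(3))
  have Na': "(\<ominus> a, N (\<ominus> a)) \<in> K" by (auto intro: D(3))
  have S: "S \<noteq> {}" "S \<subseteq> borel_measurable M" using Na D(2) by (auto simp: S_def)
  have S_min: "\<exists>h\<in>S. AE w in M. h w \<le> f w \<and> h w \<le> g w" if f: "f \<in> S" and g: "g \<in> S" for f g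
  proof -
    have [measurable]: "f \<in> borel_measurable M" "g \<in> borel_measurable M" using S f g by auto
    \<comment> \<open>Both members sit over \<open>a = 1 a\<close>, so pasting them leaves the first component alone and gives
      the pointwise minimum in the second.\<close>
    have "((\<lambda>w. if f w \<le> g w then 1 else 1) *\<^sub>E a, \<lambda>w. if f w \<le> g w then f w else g w) \<in> K"
      using f g by (intro dominating_cone_patch[OF K]) (auto simp: S_def)
    then have "(\<lambda>w. if f w \<le> g w then f w else g w) \<in> S" by (simp add: S_def)
    then show ?thesis by (rule bexI[rotated]) auto
  qed
  obtain F :: "nat \<Rightarrow> 'w \<Rightarrow> real" and c where F: "range F \<subseteq> S" and c: "c \<in> borel_measurable M"
    and bdd: "AE w in M. bdd_below (range (\<lambda>n. F n w)) \<and> c w = (INF n. F n w)"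
    and le: "\<And>f. f \<in> S \<Longrightarrow> AE w in M. c w \<le> f w"
  proof (rule directed_essential_infimum[OF S S_min lower[OF _ Na']])
    fix F :: "nat \<Rightarrow> 'w \<Rightarrow> real" and c
    assume "range F \<subseteq> S" "c \<in> borel_measurable M"
      "AE w in M. bdd_below (range (\<lambda>n. F n w)) \<and> c w = (INF n. F n w)"
      "\<And>f. f \<in> S \<Longrightarrow> AE w in M. c w \<le> f w"
    then show thesis by (rule that)
  qed
  have "AE w in M. - g w \<le> c w" if "(\<ominus> a, g) \<in> K" for g
  proof -
    have "AE w in M. \<forall>n. - g w \<le> F n w" unfolding AE_all_countable using lower[OF range_subsetD[OF F] that] ..
    with bdd show ?thesis by eventually_elim (auto intro: cINF_greatest)
  qed
  with c le show thesis by (intro that[of c]) (auto simp: S_def)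
qed

text \<open>
  Adding the line \<open>{(\<eta> a, \<eta> c). \<eta> \<in> L\<^sup>0}\<close> to the cone is consistent for the value \<open>c\<close> found above.
  Since \<open>\<eta>\<close> may be zero on a part of the space and change sign on the rest, a relation
  \<open>x + \<eta> a = 0\<close> cannot be divided by \<open>\<eta>\<close>. The divided relation is used on \<open>{\<eta> > 0}\<close> and on
  \<open>{\<eta> < 0}\<close>, pasted with a member of the cone over \<open>- a\<close> or \<open>a\<close> that the norm provides.
\<close>

lemma dominating_cone_extend:
  assumes K: "dominating_cone K" and a [simp]: "a \<in> carrier E"
  obtains c L where "dominating_cone L" "K \<subseteq> L" "(a, c) \<in> L" "(\<ominus> a, \<lambda>w. - c w) \<in> L"
proof -
  note D = dominating_coneD[OF K]
  obtain c where c [measurable]: "c \<in> borel_measurable M"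
    and c_le: "\<And>f. (a, f) \<in> K \<Longrightarrow> AE w in M. c w \<le> f w"
    and c_ge: "\<And>f. (\<ominus> a, f) \<in> K \<Longrightarrow> AE w in M. - f w \<le> c w"
    using dominating_cone_value[OF K a] by blast
  define L where "L = {(x \<oplus> \<eta> *\<^sub>E a, \<lambda>w. f w + \<eta> w * c w) | x f \<eta>. (x, f) \<in> K \<and> \<eta> \<in> borel_measurable M}"
  have L_I: "(y, g) \<in> L" if "(x, f) \<in> K" "\<eta> \<in> borel_measurable M" "y = x \<oplus> \<eta> *\<^sub>E a"
      "\<And>w. g w = f w + \<eta> w * c w" for x f \<eta> y g
    using that unfolding L_def by blast
  have zero: "(\<zero>, \<lambda>_. 0) \<in> K"
    using N_zero by (intro D(3)) (auto elim: eventually_mono)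
  have KL: "K \<subseteq> L"
  proof safe
    fix x f assume "(x, f) \<in> K"
    then show "(x, f) \<in> L" by (intro L_I[of x f "\<lambda>_. 0"]) (auto simp: D(1))
  qed
  have nonneg: "AE w in M. 0 \<le> f w + \<eta> w * c w"
    if xf: "(x, f) \<in> K" and \<eta> [measurable]: "\<eta> \<in> borel_measurable M" and eq: "x \<oplus> \<eta> *\<^sub>E a = \<zero>" for x f \<eta>
  proof -
    have x [simp]: "x \<in> carrier E" and f [measurable]: "f \<in> borel_measurable M"
      using D(1,2)[OF xf] .
    have x_eq: "x = (\<lambda>w. - \<eta> w) *\<^sub>E a"
    proof -
      have "x = \<ominus> (\<eta> *\<^sub>E a)" using eq by (simp add: M.minus_equality)
      then show ?thesis by (simp add: minus_eq_scale scale_scale)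
    qed
    \<comment> \<open>The reciprocal of \<open>|\<eta>|\<close>, and \<open>0\<close> where \<open>\<eta>\<close> vanishes.\<close>
    define u where "u w = inverse \<bar>\<eta> w\<bar>" for w
    have u [measurable]: "u \<in> borel_measurable M" unfolding u_def by measurable
    have xf': "((\<lambda>w. - \<eta> w) *\<^sub>E a, f) \<in> K" using xf x_eq by simp
    have uxf: "((\<lambda>w. u w * - \<eta> w) *\<^sub>E a, \<lambda>w. u w * f w) \<in> K"
      using D(5)[OF u _ xf'] by (simp add: scale_scale u_def)
    have N1: "((\<lambda>_. 1) *\<^sub>E a, N a) \<in> K" "((\<lambda>_. - 1) *\<^sub>E a, N (\<ominus> a)) \<in> K"
      by (auto intro!: D(3) simp flip: minus_eq_scale)
    have "((\<lambda>w. if 0 < \<eta> w then u w * - \<eta> w else - 1) *\<^sub>E a, \<lambda>w. if 0 < \<eta> w then u w * f w else N (\<ominus> a) w) \<in> K"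
      by (rule dominating_cone_patch[OF K a _ _ uxf N1(2)]) auto
    moreover have "(\<lambda>w. if 0 < \<eta> w then u w * - \<eta> w else - 1) = (\<lambda>_. - 1)"
      by (auto simp: u_def)
    ultimately have pos: "AE w in M. - (if 0 < \<eta> w then u w * f w else N (\<ominus> a) w) \<le> c w"
      using c_ge by (simp add: minus_eq_scale)
    have "((\<lambda>w. if \<eta> w < 0 then u w * - \<eta> w else 1) *\<^sub>E a, \<lambda>w. if \<eta> w < 0 then u w * f w else N a w) \<in> K"
      by (rule dominating_cone_patch[OF K a _ _ uxf N1(1)]) auto
    moreover have "(\<lambda>w. if \<eta> w < 0 then u w * - \<eta> w else 1) = (\<lambda>_. 1)"
      by (auto simp: u_def)
    ultimately have neg: "AE w in M. c w \<le> (if \<eta> w < 0 then u w * f w else N a w)"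
      using c_le by simp
    have "((\<lambda>w. if \<eta> w = 0 then - \<eta> w else 0) *\<^sub>E a, \<lambda>w. if \<eta> w = 0 then f w else 0) \<in> K"
      by (rule dominating_cone_patch[OF K a _ _ xf']) (auto simp: zero)
    moreover have "(\<lambda>w. if \<eta> w = 0 then - \<eta> w else 0) = (\<lambda>_. 0)" by auto
    ultimately have null: "AE w in M. 0 \<le> (if \<eta> w = 0 then f w else 0)"
      using D(6) by simp
    from pos neg null show ?thesis
    proof eventually_elim
      case (elim w)
      consider "0 < \<eta> w" | "\<eta> w < 0" | "\<eta> w = 0" by linarith
      then show ?case
      proof cases
        case 1
        then have "- (f w / \<eta> w) \<le> c w" using elim(1) by (simp add: u_def divide_inverse mult.commute)
        with 1 show ?thesis by (simp add: field_simps)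
      next
        case 2
        then have "c w \<le> - (f w / \<eta> w)" using elim(2) by (simp add: u_def divide_inverse mult.commute)
        with 2 show ?thesis by (simp add: field_simps)
      qed (use elim in simp)
    qed
  qed
  have "dominating_cone L"
    unfolding dominating_cone_def
  proof (intro conjI allI impI ballI)
    show "L \<subseteq> carrier E \<times> borel_measurable M"
    proof safe
      fix y g assume "(y, g) \<in> L"
      then obtain x f \<eta> where *: "(x, f) \<in> K" "\<eta> \<in> borel_measurable M" "y = x \<oplus> \<eta> *\<^sub>E a"
        "g = (\<lambda>w. f w + \<eta> w * c w)" unfolding L_def by blast
      then show "y \<in> carrier E" "g \<in> borel_measurable M"
        using D(1,2)[OF *(1)] by auto
    qed
  next
    fix x f assume "x \<in> carrier E" "f \<in> borel_measurable M" "AE w in M. N x w \<le> f w"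
    then show "(x, f) \<in> L" using D(3) KL by blast
  next
    fix y g y' g' assume "(y, g) \<in> L" "(y', g') \<in> L"
    then obtain x f \<eta> x' f' \<eta>' where *: "(x, f) \<in> K" "\<eta> \<in> borel_measurable M" "y = x \<oplus> \<eta> *\<^sub>E a"
        "g = (\<lambda>w. f w + \<eta> w * c w)" "(x', f') \<in> K" "\<eta>' \<in> borel_measurable M" "y' = x' \<oplus> \<eta>' *\<^sub>E a"
        "g' = (\<lambda>w. f' w + \<eta>' w * c w)"
      unfolding L_def by blast
    then have "x \<in> carrier E" "x' \<in> carrier E" using D(1) by blast+
    then show "(y \<oplus> y', \<lambda>w. g w + g' w) \<in> L"
      using * by (intro L_I[OF D(4)[OF *(1,5)], of "\<lambda>w. \<eta> w + \<eta>' w"])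
        (auto simp: M.a_ac algebra_simps simp flip: scale_add_left)
  next
    fix t :: "'w \<Rightarrow> real" and y g assume t: "t \<in> borel_measurable M" "AE w in M. 0 \<le> t w" and "(y, g) \<in> L"
    then obtain x f \<eta> where *: "(x, f) \<in> K" "\<eta> \<in> borel_measurable M" "y = x \<oplus> \<eta> *\<^sub>E a"
        "g = (\<lambda>w. f w + \<eta> w * c w)" unfolding L_def by blast
    then have "x \<in> carrier E" using D(1) by blast
    then show "(t *\<^sub>E y, \<lambda>w. t w * g w) \<in> L"
      using * t by (intro L_I[OF D(5)[OF t *(1)], of "\<lambda>w. t w * \<eta> w"])
        (auto simp: scale_add_right scale_scale algebra_simps)
  next
    fix g assume "(\<zero>, g) \<in> L"
    then show "AE w in M. 0 \<le> g w" unfolding L_def using nonneg by force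
  qed
  moreover have "(a, c) \<in> L"
    by (intro L_I[OF zero, of "\<lambda>_. 1"]) auto
  moreover have "(\<ominus> a, \<lambda>w. - c w) \<in> L"
    by (intro L_I[OF zero, of "\<lambda>_. - 1"]) (auto simp flip: minus_eq_scale)
  ultimately show thesis using that KL by blast
qed

definition linear_functional :: "('e \<Rightarrow> 'w \<Rightarrow> real) \<Rightarrow> bool" where
  "linear_functional \<phi> \<longleftrightarrow> (\<forall>x\<in>carrier E. \<phi> x \<in> borel_measurable M) \<and>
     (\<forall>x\<in>carrier E. \<forall>y\<in>carrier E. AE w in M. \<phi> (x \<oplus> y) w = \<phi> x w + \<phi> y w) \<and>
     (\<forall>\<eta>\<in>borel_measurable M. \<forall>x\<in>carrier E. AE w in M. \<phi> (\<eta> *\<^sub>E x) w = \<eta> w * \<phi> x w)"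

lemma linear_functionalD:
  assumes "linear_functional \<phi>"
  shows "x \<in> carrier E \<Longrightarrow> \<phi> x \<in> borel_measurable M"
    and "x \<in> carrier E \<Longrightarrow> y \<in> carrier E \<Longrightarrow> AE w in M. \<phi> (x \<oplus> y) w = \<phi> x w + \<phi> y w"
    and "\<eta> \<in> borel_measurable M \<Longrightarrow> x \<in> carrier E \<Longrightarrow> AE w in M. \<phi> (\<eta> *\<^sub>E x) w = \<eta> w * \<phi> x w"
  using assms unfolding linear_functional_def by blast+

text \<open>
  In a maximal cone \<open>L\<close> every vector \<open>a\<close> has a value \<open>c\<close> with both \<open>(a, c)\<close> and \<open>(- a, - c)\<close> in
  \<open>L\<close>. Such a value is unique up to a null set, because the difference of two values is nonnegative
  in both directions, and uniqueness turns the closure properties of the cone into linearity.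
\<close>

lemma linear_functional_below_cone:
  assumes K: "dominating_cone K"
  obtains \<phi> where "linear_functional \<phi>"
    "\<And>x f. (x, f) \<in> K \<Longrightarrow> AE w in M. \<phi> x w \<le> f w"
proof -
  obtain L where L: "dominating_cone L" "K \<subseteq> L"
    and maximal: "\<And>L'. dominating_cone L' \<Longrightarrow> L \<subseteq> L' \<Longrightarrow> L' = L"
    using maximal_dominating_cone[OF K] by blast
  note D = dominating_coneD[OF L(1)]
  have "\<exists>c. (a, c) \<in> L \<and> (\<ominus> a, \<lambda>w. - c w) \<in> L" if "a \<in> carrier E" for a
    using dominating_cone_extend[OF L(1) that] maximal by metis
  then obtain \<phi> where \<phi>: "\<And>a. a \<in> carrier E \<Longrightarrow> (a, \<phi> a) \<in> L"
      "\<And>a. a \<in> carrier E \<Longrightarrow> (\<ominus> a, \<lambda>w. - \<phi> a w) \<in> L"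
    by metis
  have \<phi>_le: "AE w in M. \<phi> a w \<le> f w" if "(a, f) \<in> L" for a f
  proof -
    have a: "a \<in> carrier E" using D(1)[OF that] .
    have "(\<zero>, \<lambda>w. f w + - \<phi> a w) \<in> L"
      using D(4)[OF that \<phi>(2)[OF a]] a by (simp add: M.r_neg)
    from D(6)[OF this] show ?thesis by eventually_elim simp
  qed
  have \<phi>_eq: "AE w in M. \<phi> a w = f w" if "(a, f) \<in> L" "(\<ominus> a, \<lambda>w. - f w) \<in> L" for a f
  proof -
    have a: "a \<in> carrier E" using D(1)[OF that(1)] .
    have "(\<zero>, \<lambda>w. \<phi> a w + - f w) \<in> L"
      using D(4)[OF \<phi>(1)[OF a] that(2)] a by (simp add: M.r_neg)
    from D(6)[OF this] \<phi>_le[OF that(1)] show ?thesis by eventually_elim simp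
  qed
  have meas [measurable]: "\<phi> x \<in> borel_measurable M" if "x \<in> carrier E" for x
    using D(2)[OF \<phi>(1)[OF that]] .
  have "AE w in M. \<phi> (x \<oplus> y) w = \<phi> x w + \<phi> y w" if [simp]: "x \<in> carrier E" "y \<in> carrier E" for x y
  proof (rule \<phi>_eq)
    show "(x \<oplus> y, \<lambda>w. \<phi> x w + \<phi> y w) \<in> L" by (intro D(4) \<phi>(1)) auto
    have "(\<ominus> x \<oplus> \<ominus> y, \<lambda>w. - \<phi> x w + - \<phi> y w) \<in> L" by (intro D(4) \<phi>(2)) auto
    then show "(\<ominus> (x \<oplus> y), \<lambda>w. - (\<phi> x w + \<phi> y w)) \<in> L" by (simp add: M.minus_add)
  qed
  moreover have "AE w in M. \<phi> (\<eta> *\<^sub>E x) w = \<eta> w * \<phi> x w"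
    if [measurable]: "\<eta> \<in> borel_measurable M" and x [simp]: "x \<in> carrier E" for \<eta> x
  proof -
    have *: "(\<theta> *\<^sub>E x, \<lambda>w. \<theta> w * \<phi> x w) \<in> L" if [measurable]: "\<theta> \<in> borel_measurable M" for \<theta>
    proof -
      \<comment> \<open>Only nonnegative multipliers act on the cone, so \<open>\<theta>\<close> is split into \<open>p - n\<close> and \<open>n\<close> acts on
        the member over \<open>- x\<close>.\<close>
      define p n where "p w = max 0 (\<theta> w)" and "n w = max 0 (- \<theta> w)" for w
      have pn [measurable]: "p \<in> borel_measurable M" "n \<in> borel_measurable M"
        unfolding p_def n_def by measurable
      have "(p *\<^sub>E x, \<lambda>w. p w * \<phi> x w) \<in> L" "(n *\<^sub>E \<ominus> x, \<lambda>w. n w * - \<phi> x w) \<in> L"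
        using D(5)[OF pn(1) _ \<phi>(1)[OF x]] D(5)[OF pn(2) _ \<phi>(2)[OF x]]
        by (simp_all add: p_def n_def)
      from D(4)[OF this]
      have "(p *\<^sub>E x \<oplus> n *\<^sub>E \<ominus> x, \<lambda>w. p w * \<phi> x w + n w * - \<phi> x w) \<in> L" .
      moreover have "p *\<^sub>E x \<oplus> n *\<^sub>E \<ominus> x = (\<lambda>w. p w + n w * - 1) *\<^sub>E x"
        by (subst scale_add_left[symmetric]) (simp_all add: minus_eq_scale scale_scale)
      moreover have "(\<lambda>w. p w + n w * - 1) = \<theta>" "(\<lambda>w. p w * \<phi> x w + n w * - \<phi> x w) = (\<lambda>w. \<theta> w * \<phi> x w)"
        by (auto simp: p_def n_def max_def)
      ultimately show ?thesis by simp
    qed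
    show ?thesis
      using *[of \<eta>] *[of "\<lambda>w. - \<eta> w"] by (intro \<phi>_eq) (simp_all add: minus_eq_scale scale_scale)
  qed
  ultimately show thesis
    using that[of \<phi>] meas \<phi>_le L(2) unfolding linear_functional_def by blast
qed

text \<open>
  The sublinear functional behind the cone used here is
  \<open>x \<mapsto> ess inf {\<parallel>x + t d\<parallel> - t u. t \<ge> 0, d \<in> D}\<close>. To avoid forming the infimum, the cone collects
  the pairs \<open>(x, f)\<close> with \<open>f\<close> above one of the terms. No pair \<open>(0, f)\<close> in it has a negative \<open>f\<close>,
  because \<open>t u \<le> t \<parallel>d\<parallel>\<close>. Taking \<open>t = 0\<close> shows that it contains the epigraph of the norm, and taking
  \<open>t = 1\<close> that it contains \<open>(- d, - u)\<close>, so a functional below it satisfies \<open>\<phi>(d) \<ge> u\<close>.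
\<close>

lemma separate_convex_set_from_zero:
  assumes "D \<noteq> {}" and D: "D \<subseteq> carrier E" and u [measurable]: "u \<in> borel_measurable M"
    and convex: "\<And>x y \<theta>. x \<in> D \<Longrightarrow> y \<in> D \<Longrightarrow> \<theta> \<in> borel_measurable M \<Longrightarrow>
      (\<And>w. 0 \<le> \<theta> w \<and> \<theta> w \<le> 1) \<Longrightarrow> \<theta> *\<^sub>E x \<oplus> (\<lambda>w. 1 - \<theta> w) *\<^sub>E y \<in> D"
    and far: "\<And>x. x \<in> D \<Longrightarrow> AE w in M. u w \<le> N x w"
  obtains \<phi> where "linear_functional \<phi>"
    "\<And>x. x \<in> carrier E \<Longrightarrow> AE w in M. \<bar>\<phi> x w\<bar> \<le> N x w"
    "\<And>x. x \<in> D \<Longrightarrow> AE w in M. u w \<le> \<phi> x w"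
proof -
  define nn where "nn t \<longleftrightarrow> t \<in> borel_measurable M \<and> (\<forall>w. 0 \<le> t w)" for t :: "'w \<Rightarrow> real"
  define K where "K = {(x, f). x \<in> carrier E \<and> f \<in> borel_measurable M \<and>
    (\<exists>t d. nn t \<and> d \<in> D \<and> (AE w in M. N (x \<oplus> t *\<^sub>E d) w - t w * u w \<le> f w))}"
  have K_I: "(x, f) \<in> K" if "x \<in> carrier E" "f \<in> borel_measurable M" "nn t" "d \<in> D"
      "AE w in M. N (x \<oplus> t *\<^sub>E d) w - t w * u w \<le> f w" for x f t d
    using that unfolding K_def by blast
  have DE [simp]: "d \<in> carrier E" if "d \<in> D" for d using D that by blast
  have tm: "t \<in> borel_measurable M" if "nn t" for t using that by (simp add: nn_def)
  have "dominating_cone K"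
    unfolding dominating_cone_def
  proof (intro conjI allI impI ballI)
    show "K \<subseteq> carrier E \<times> borel_measurable M" by (auto simp: K_def)
  next
    fix x f assume x: "x \<in> carrier E" and f: "f \<in> borel_measurable M" and le: "AE w in M. N x w \<le> f w"
    obtain d where d: "d \<in> D" using \<open>D \<noteq> {}\<close> by blast
    show "(x, f) \<in> K"
      by (rule K_I[of x f "\<lambda>_. 0" d]) (use x f le d in \<open>simp_all add: nn_def\<close>)
  next
    fix x f y g assume "(x, f) \<in> K" "(y, g) \<in> K"
    then obtain s d t e where x [simp]: "x \<in> carrier E" and [measurable]: "f \<in> borel_measurable M"
      and y [simp]: "y \<in> carrier E" and [measurable]: "g \<in> borel_measurable M"
      and s: "nn s" and d: "d \<in> D" and t: "nn t" and e: "e \<in> D"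
      and xs: "AE w in M. N (x \<oplus> s *\<^sub>E d) w - s w * u w \<le> f w"
      and yt: "AE w in M. N (y \<oplus> t *\<^sub>E e) w - t w * u w \<le> g w"
      unfolding K_def by blast
    have st [measurable]: "s \<in> borel_measurable M" "t \<in> borel_measurable M" using s t tm by auto
    \<comment> \<open>The weight that turns \<open>s d + t e\<close> into a multiple of a single element of \<open>D\<close>. Where
      \<open>s + t = 0\<close> both multipliers vanish, and the default value \<open>0\<close> of the quotient is a legitimate weight.\<close>
    define \<theta> where "\<theta> w = s w / (s w + t w)" for w
    have \<theta> [measurable]: "\<theta> \<in> borel_measurable M" unfolding \<theta>_def by measurable
    have nonneg: "0 \<le> s w" "0 \<le> t w" for w using s t by (auto simp: nn_def)
    have "0 \<le> \<theta> w \<and> \<theta> w \<le> 1" for w using nonneg[of w] by (auto simp: \<theta>_def divide_le_eq_1)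
    then have D': "\<theta> *\<^sub>E d \<oplus> (\<lambda>w. 1 - \<theta> w) *\<^sub>E e \<in> D" (is "?d \<in> D") by (intro convex d e \<theta>)
    have \<theta>_s: "(s w + t w) * \<theta> w = s w" for w
    proof (cases "s w + t w = 0")
      case True
      then have "s w = 0" using nonneg[of w] by linarith
      with True show ?thesis by simp
    qed (simp add: \<theta>_def)
    then have "(s w + t w) * (1 - \<theta> w) = t w" for w by (simp add: right_diff_distrib)
    with \<theta>_s have st_d: "(\<lambda>w. s w + t w) *\<^sub>E ?d = s *\<^sub>E d \<oplus> t *\<^sub>E e"
      using d e by (simp add: scale_add_right scale_scale)
    have eq: "x \<oplus> y \<oplus> (\<lambda>w. s w + t w) *\<^sub>E ?d = (x \<oplus> s *\<^sub>E d) \<oplus> (y \<oplus> t *\<^sub>E e)"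
      unfolding st_d using d e by (simp add: M.a_ac)
    show "(x \<oplus> y, \<lambda>w. f w + g w) \<in> K"
    proof (rule K_I[of _ _ "\<lambda>w. s w + t w" ?d])
      show "AE w in M. N (x \<oplus> y \<oplus> (\<lambda>w. s w + t w) *\<^sub>E ?d) w - (s w + t w) * u w \<le> f w + g w"
        using xs yt N_triangle[of "x \<oplus> s *\<^sub>E d" "y \<oplus> t *\<^sub>E e"] d e unfolding eq
        by (auto elim!: AE_mp simp: algebra_simps)
    qed (use D' nonneg in \<open>auto simp: nn_def\<close>)
  next
    fix t :: "'w \<Rightarrow> real" and x f
    assume t [measurable]: "t \<in> borel_measurable M" and t0: "AE w in M. 0 \<le> t w" and "(x, f) \<in> K"
    then obtain s d where x [simp]: "x \<in> carrier E" and [measurable]: "f \<in> borel_measurable M"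
      and s: "nn s" and d: "d \<in> D" and xs: "AE w in M. N (x \<oplus> s *\<^sub>E d) w - s w * u w \<le> f w"
      unfolding K_def by blast
    have s' [measurable]: "s \<in> borel_measurable M" using s by (rule tm)
    \<comment> \<open>\<open>t\<close> is nonnegative up to a null set only, whereas \<open>nn\<close> asks for nonnegativity everywhere;
      passing to \<open>|t|\<close> does not change the class.\<close>
    let ?t = "\<lambda>w. \<bar>t w\<bar> * s w"
    have t_eq: "t *\<^sub>E y = (\<lambda>w. \<bar>t w\<bar>) *\<^sub>E y" for y
      using t0 by (intro scale_cong_AE) (auto elim!: AE_mp)
    have eq: "t *\<^sub>E x \<oplus> ?t *\<^sub>E d = (\<lambda>w. \<bar>t w\<bar>) *\<^sub>E (x \<oplus> s *\<^sub>E d)"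
      using d by (simp add: t_eq scale_add_right scale_scale)
    show "(t *\<^sub>E x, \<lambda>w. t w * f w) \<in> K"
    proof (rule K_I[of _ _ ?t d])
      have "AE w in M. N (t *\<^sub>E x \<oplus> ?t *\<^sub>E d) w = \<bar>t w\<bar> * N (x \<oplus> s *\<^sub>E d) w"
        using N_scale[of "\<lambda>w. \<bar>t w\<bar>" "x \<oplus> s *\<^sub>E d"] d unfolding eq by simp
      with xs t0 show "AE w in M. N (t *\<^sub>E x \<oplus> ?t *\<^sub>E d) w - ?t w * u w \<le> t w * f w"
      proof eventually_elim
        case (elim w)
        then have "t w * (N (x \<oplus> s *\<^sub>E d) w - s w * u w) \<le> t w * f w" by (intro mult_left_mono)
        with elim show ?case by (simp add: algebra_simps)
      qed
    qed (use d s in \<open>auto simp: nn_def\<close>)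
  next
    fix f assume "(\<zero>, f) \<in> K"
    then obtain t d where t: "nn t" and d: "d \<in> D"
      and le: "AE w in M. N (\<zero> \<oplus> t *\<^sub>E d) w - t w * u w \<le> f w"
      unfolding K_def by blast
    have "AE w in M. N (t *\<^sub>E d) w = \<bar>t w\<bar> * N d w" using t d by (intro N_scale tm) auto
    with le far[OF d] show "AE w in M. 0 \<le> f w"
    proof eventually_elim
      case (elim w)
      have "0 \<le> t w" using t by (simp add: nn_def)
      then have "t w * u w \<le> t w * N d w" using elim by (intro mult_left_mono)
      then show ?case using elim \<open>0 \<le> t w\<close> tm[OF t] d by simp
    qed
  qed
  then obtain \<phi> where \<phi>: "linear_functional \<phi>"
    and le: "\<And>x f. (x, f) \<in> K \<Longrightarrow> AE w in M. \<phi> x w \<le> f w"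
    using linear_functional_below_cone by blast
  have \<phi>_minus: "AE w in M. \<phi> (\<ominus> x) w = - \<phi> x w" if "x \<in> carrier E" for x
  proof -
    have "AE w in M. \<phi> ((\<lambda>_. - 1) *\<^sub>E x) w = - 1 * \<phi> x w"
      using that by (intro linear_functionalD(3)[OF \<phi>]) auto
    with that show ?thesis by (simp add: minus_eq_scale)
  qed
  have le_N: "AE w in M. \<phi> x w \<le> N x w" if "x \<in> carrier E" for x
    using dominating_coneD(3)[OF \<open>dominating_cone K\<close> that, of "N x"] that by (intro le) auto
  show thesis
  proof (rule that[OF \<phi>])
    fix x assume x: "x \<in> carrier E"
    then have "\<ominus> x \<in> carrier E" by simp
    from le_N[OF x] le_N[OF this] \<phi>_minus[OF x] N_minus[OF x]
    show "AE w in M. \<bar>\<phi> x w\<bar> \<le> N x w" by eventually_elim simp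
  next
    fix x assume x: "x \<in> D"
    have "AE w in M. N \<zero> w - 1 * u w \<le> - u w" using N_zero by eventually_elim simp
    then have "AE w in M. N (\<ominus> x \<oplus> (\<lambda>_. 1) *\<^sub>E x) w - 1 * u w \<le> - u w"
      using x by (simp add: M.l_neg)
    then have "(\<ominus> x, \<lambda>w. - u w) \<in> K"
      using x by (intro K_I[of _ _ "\<lambda>_. 1" x]) (auto simp: nn_def)
    from le[OF this] \<phi>_minus[OF DE[OF x]] show "AE w in M. u w \<le> \<phi> x w" by eventually_elim simp
  qed
qed

section \<open>Continuous functionals and the weak topology\<close>

lemma linear_functional_in_dual:
  assumes \<phi>: "linear_functional \<phi>" and bound: "\<And>x. x \<in> carrier E \<Longrightarrow> AE w in M. \<bar>\<phi> x w\<bar> \<le> N x w"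
  shows "(\<lambda>x\<in>carrier E. L0_class M (\<phi> x)) \<in> L0_dual M E nrm" (is "?\<mu> \<in> _")
proof -
  note L = linear_functionalD[OF \<phi>]
  have nrm_nonneg: "nrm \<in> carrier E \<rightarrow> L0_nonneg M"
    using nrm by (auto simp: L0_seminorm_def)
  have \<mu>: "?\<mu> x \<in> carrier (L0 M)" if "x \<in> carrier E" for x
    using that L(1) by (simp add: L0_class_in_carrier)
  have add: "?\<mu> (x \<oplus> y) = ?\<mu> x \<oplus>\<^bsub>L0 M\<^esub> ?\<mu> y" if [simp]: "x \<in> carrier E" "y \<in> carrier E" for x y
    using L(1,2)[of x] L(1)[of y] L(1)[of "x \<oplus> y"] L(2)[of x y] by (simp add: L0_add L0_class_eq_iff)
  have mult: "?\<mu> (\<eta> \<odot> x) = \<eta> \<otimes>\<^bsub>L0 M\<^esub> ?\<mu> x" if \<eta>: "\<eta> \<in> carrier (L0 M)" and [simp]: "x \<in> carrier E" for \<eta> x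
  proof -
    obtain h where h: "h \<in> borel_measurable M" "\<eta> = L0_class M h"
      using \<eta> by (auto simp: carrier_L0)
    then have "\<eta> \<odot> x = h *\<^sub>E x" by (simp add: scale_def)
    with h L(1)[of x] L(1)[of "h *\<^sub>E x"] L(3)[of h x] show ?thesis
      by (simp add: L0_mult L0_class_eq_iff)
  qed
  have open_carrier: "openin (seminorm_topology M E {nrm}) (carrier E)"
    using nrm_nonneg L0_one_pos
    by (subst openin_seminorm_topology) (auto simp: seminorm_nbhd_def intro!: exI[of _ "{}"] exI[of _ "\<one>\<^bsub>L0 M\<^esub>"])
  have cont: "continuous_map (seminorm_topology M E {nrm}) (L0_topology M) ?\<mu>"
    unfolding continuous_map_def
  proof (intro conjI allI impI)
    have top: "topspace (seminorm_topology M E {nrm}) = carrier E"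
      using openin_subset[OF open_carrier] openin_seminorm_topology[of "{nrm}" E M] nrm_nonneg
      by (metis openin_topspace singletonD subset_antisym)
    have "openin (L0_topology M) (carrier (L0 M))"
      using L0_one_pos by (auto simp: openin_L0_topology L0_ball_def)
    then show "?\<mu> \<in> topspace (seminorm_topology M E {nrm}) \<rightarrow> topspace (L0_topology M)"
      using \<mu> openin_subset[of "L0_topology M" "carrier (L0 M)"] unfolding top by fastforce
    fix U assume U: "openin (L0_topology M) U"
    show "openin (seminorm_topology M E {nrm}) {x \<in> topspace (seminorm_topology M E {nrm}). ?\<mu> x \<in> U}"
      unfolding top
    proof (subst openin_seminorm_topology, goal_cases)
      case 2
      show ?case
      proof (intro conjI ballI)
        fix x assume "x \<in> {x \<in> carrier E. ?\<mu> x \<in> U}"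
        then have x: "x \<in> carrier E" "?\<mu> x \<in> U" by auto
        then obtain \<epsilon> where \<epsilon>: "\<epsilon> \<in> L0_pos M" "(\<lambda>\<xi>. ?\<mu> x \<oplus>\<^bsub>L0 M\<^esub> \<xi>) ` L0_ball M \<epsilon> \<subseteq> U"
          using U unfolding openin_L0_topology by blast
        have "x \<oplus> y \<in> {x \<in> carrier E. ?\<mu> x \<in> U}" if "y \<in> seminorm_nbhd M E {nrm} \<epsilon>" for y
        proof -
          have y: "y \<in> carrier E" "L0_le M (nrm y) \<epsilon>"
            using that \<epsilon>(1) nrm_nonneg by (auto simp: seminorm_nbhd_eq)
          have "L0_le M (L0_abs M (?\<mu> y)) (nrm y)"
            using y(1) bound[of y] L(1)[of y] by (simp add: L0_abs_class nrm_eq L0_le_class)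
          then have "L0_le M (L0_abs M (?\<mu> y)) \<epsilon>"
            by (rule L0_le_trans[rotated 3, OF _ y(2)])
              (use y(1) \<mu>[of y] \<epsilon>(1) nrm_nonneg in \<open>auto simp: L0_pos_carrier L0_class_in_carrier nrm_eq L0_nonneg_carrier L0_abs_nonneg\<close>)
          then have "?\<mu> x \<oplus>\<^bsub>L0 M\<^esub> ?\<mu> y \<in> U" using \<epsilon>(2) \<mu>[OF y(1)] by (auto simp: L0_ball_def)
          then show ?thesis using add[OF x(1) y(1)] x(1) y(1) by simp
        qed
        then show "\<exists>F \<epsilon>. finite F \<and> F \<subseteq> {nrm} \<and> \<epsilon> \<in> L0_pos M \<and>
            (\<oplus>) x ` seminorm_nbhd M E F \<epsilon> \<subseteq> {x \<in> carrier E. ?\<mu> x \<in> U}"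
          using \<epsilon>(1) by (intro exI[of _ "{nrm}"] exI[of _ \<epsilon>]) blast
      qed auto
    qed (use nrm_nonneg in auto)
  qed
  have "?\<mu> \<in> carrier E \<rightarrow>\<^sub>E carrier (L0 M)"
    using L(1) by (auto simp: L0_class_in_carrier)
  with add mult cont show ?thesis unfolding L0_dual_def mem_Collect_eq by blast
qed

text \<open>
  The basic weak neighbourhoods are defined by non-strict inequalities and need not be open. The strict
  inequality used here holds with a margin at each point, and half of that margin, which is again
  an element of \<open>L\<^sup>0\<close> positive almost surely, is the radius of a neighbourhood inside the set.
\<close>

lemma weakly_open_slab:
  assumes \<phi>: "linear_functional \<phi>" and bound: "\<And>x. x \<in> carrier E \<Longrightarrow> AE w in M. \<bar>\<phi> x w\<bar> \<le> N x w"
    and l [simp]: "l \<in> carrier E" and \<delta> [measurable]: "\<delta> \<in> borel_measurable M"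
  shows "openin (weak_topology M E nrm) {y \<in> carrier E. AE w in M. \<bar>\<phi> y w - \<phi> l w\<bar> < \<delta> w}"
    (is "openin _ ?U")
  unfolding weak_topology_def
proof (subst openin_seminorm_topology, goal_cases)
  case (1 p)
  then obtain \<nu> where \<nu>: "\<nu> \<in> L0_dual M E nrm" "p = (\<lambda>x. L0_abs M (\<nu> x))" by blast
  then have "\<nu> \<in> carrier E \<rightarrow> carrier (L0 M)" by (auto simp: L0_dual_def)
  then show ?case unfolding \<nu>(2) by (auto intro: L0_abs_nonneg)
next
  case 2
  note L = linear_functionalD[OF \<phi>]
  let ?\<mu> = "\<lambda>x\<in>carrier E. L0_class M (\<phi> x)"
  define p where "p x = L0_abs M (?\<mu> x)" for x
  have p: "p \<in> (\<lambda>\<mu> x. L0_abs M (\<mu> x)) ` L0_dual M E nrm"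
    using linear_functional_in_dual[OF \<phi> bound] by (auto simp: p_def fun_eq_iff intro!: rev_image_eqI)
  have p_eq: "p x = L0_class M (\<lambda>w. \<bar>\<phi> x w\<bar>)" if "x \<in> carrier E" for x
    using that L(1) by (simp add: p_def L0_abs_class)
  have p_nonneg: "p \<in> carrier E \<rightarrow> L0_nonneg M"
    using L(1) by (auto simp: p_def L0_abs_nonneg L0_class_in_carrier)
  show ?case
  proof (intro conjI ballI)
    fix y assume "y \<in> ?U"
    then have y [simp]: "y \<in> carrier E" and less: "AE w in M. \<bar>\<phi> y w - \<phi> l w\<bar> < \<delta> w" by auto
    have [measurable]: "\<phi> y \<in> borel_measurable M" "\<phi> l \<in> borel_measurable M" by (rule L(1), simp)+
    define e where "e w = (\<delta> w - \<bar>\<phi> y w - \<phi> l w\<bar>) / 2" for w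
    have e [measurable]: "e \<in> borel_measurable M" unfolding e_def by measurable
    have e_pos: "L0_class M e \<in> L0_pos M"
      unfolding L0_pos_iff using less e by (intro bexI[of _ e]) (auto simp: e_def)
    have "y \<oplus> z \<in> ?U" if "z \<in> seminorm_nbhd M E {p} (L0_class M e)" for z
    proof -
      have z: "z \<in> carrier E" "L0_le M (p z) (L0_class M e)"
        using that e_pos p_nonneg by (auto simp: seminorm_nbhd_eq)
      have [measurable]: "\<phi> z \<in> borel_measurable M" using L(1) z(1) .
      have "AE w in M. \<bar>\<phi> z w\<bar> \<le> e w"
        using z by (simp add: p_eq L0_le_class)
      with less L(2)[OF y z(1)] have "AE w in M. \<bar>\<phi> (y \<oplus> z) w - \<phi> l w\<bar> < \<delta> w"
      proof eventually_elim
        case (elim w)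
        then have "\<bar>\<phi> z w\<bar> \<le> (\<delta> w - \<bar>\<phi> y w - \<phi> l w\<bar>) / 2" by (simp only: e_def)
        moreover have "\<bar>\<phi> y w + \<phi> z w - \<phi> l w\<bar> \<le> \<bar>\<phi> y w - \<phi> l w\<bar> + \<bar>\<phi> z w\<bar>"
          using abs_triangle_ineq[of "\<phi> y w - \<phi> l w" "\<phi> z w"] by (simp add: algebra_simps)
        ultimately show ?case unfolding elim(2) using elim(1) by (simp add: field_simps)
      qed
      then show ?thesis using z(1) by simp
    qed
    then show "\<exists>F \<epsilon>. finite F \<and> F \<subseteq> (\<lambda>\<mu> x. L0_abs M (\<mu> x)) ` L0_dual M E nrm \<and> \<epsilon> \<in> L0_pos M \<and>
        (\<oplus>) y ` seminorm_nbhd M E F \<epsilon> \<subseteq> ?U"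
      using e_pos p by (intro exI[of _ "{p}"] exI[of _ "L0_class M e"]) blast
  qed auto
qed

lemma weak_limit_eventually:
  assumes \<phi>: "linear_functional \<phi>" and bound: "\<And>x. x \<in> carrier E \<Longrightarrow> AE w in M. \<bar>\<phi> x w\<bar> \<le> N x w"
    and lim: "limitin (weak_topology M E nrm) x l F" and l: "l \<in> carrier E"
    and \<delta>: "\<delta> \<in> borel_measurable M" "AE w in M. 0 < \<delta> w"
  shows "eventually (\<lambda>g. AE w in M. \<bar>\<phi> (x g) w - \<phi> l w\<bar> < \<delta> w) F"
proof -
  have "eventually (\<lambda>g. x g \<in> {y \<in> carrier E. AE w in M. \<bar>\<phi> y w - \<phi> l w\<bar> < \<delta> w}) F"
    using lim weakly_open_slab[OF \<phi> bound l \<delta>(1)] l \<delta>(2) unfolding limitin_def by force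
  then show ?thesis by (rule eventually_mono) simp
qed

end

section \<open>Relative stability\<close>

lemma relatively_stableD:
  "relatively_stable M E K \<Longrightarrow> range x \<subseteq> K \<Longrightarrow> partition_seq M A \<Longrightarrow> is_concatenation M E x A z \<Longrightarrow> z \<in> K"
  unfolding relatively_stable_def by blast

lemma partition_seq_sets: "partition_seq M A \<Longrightarrow> A k \<in> sets M"
  by (auto simp: partition_seq_def)

text \<open>
  Refining each event of a partition by a partition of its own; the two indices are merged by the
  pairing function on the natural numbers.
\<close>

lemma partition_seq_refine:
  assumes B: "partition_seq M B" and A: "\<And>k. partition_seq M (A k)"
  shows "partition_seq M (\<lambda>n. B (fst (prod_decode n)) \<inter> A (fst (prod_decode n)) (snd (prod_decode n)))"
    (is "partition_seq M ?C")
  unfolding partition_seq_def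
proof (intro conjI allI impI)
  show "range ?C \<subseteq> sets M" using partition_seq_sets[OF A] partition_seq_sets[OF B] by auto
next
  fix m n :: nat assume "m \<noteq> n"
  then have "prod_decode m \<noteq> prod_decode n" by simp
  then consider "fst (prod_decode m) \<noteq> fst (prod_decode n)"
    | "fst (prod_decode m) = fst (prod_decode n)" "snd (prod_decode m) \<noteq> snd (prod_decode n)"
    by (auto simp: prod_eq_iff)
  then show "?C m \<inter> ?C n \<in> null_sets M"
  proof cases
    case 1
    then have "B (fst (prod_decode m)) \<inter> B (fst (prod_decode n)) \<in> null_sets M"
      using B by (simp add: partition_seq_def)
    then show ?thesis
      by (rule null_sets_subset) (use partition_seq_sets[OF A] partition_seq_sets[OF B] in auto)
  next
    case 2
    then have "A (fst (prod_decode m)) (snd (prod_decode m)) \<inter> A (fst (prod_decode m)) (snd (prod_decode n)) \<in> null_sets M"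
      using A by (simp add: partition_seq_def)
    then show ?thesis
      by (rule null_sets_subset) (use 2 partition_seq_sets[OF A] partition_seq_sets[OF B] in auto)
  qed
next
  have "space M - (\<Union>k. B k) \<union> (\<Union>k. space M - (\<Union>j. A k j)) \<in> null_sets M"
    using A B by (intro null_sets.Un null_sets_UN) (auto simp: partition_seq_def)
  then show "space M - (\<Union>n. ?C n) \<in> null_sets M"
  proof (rule null_sets_subset)
    show "space M - (\<Union>n. ?C n) \<in> sets M"
      using partition_seq_sets[OF A] partition_seq_sets[OF B] by (intro sets.Diff sets.countable_UN) auto
    show "space M - (\<Union>n. ?C n) \<subseteq> space M - (\<Union>k. B k) \<union> (\<Union>k. space M - (\<Union>j. A k j))"
    proof
      fix w assume w: "w \<in> space M - (\<Union>n. ?C n)"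
      show "w \<in> space M - (\<Union>k. B k) \<union> (\<Union>k. space M - (\<Union>j. A k j))"
      proof (rule ccontr)
        assume "\<not> ?thesis"
        with w obtain k j where "w \<in> B k" "w \<in> A k j" by blast
        then have "w \<in> ?C (prod_encode (k, j))" by simp
        with w show False by blast
      qed
    qed
  qed
qed

context L0_seminormed
begin

lemma indicator_scale: "L0_indicator M A \<odot> x = indicator A *\<^sub>E x"
  by (simp add: L0_indicator_def scale_def)

lemma subset_stable_hull: "K \<subseteq> carrier E \<Longrightarrow> K \<subseteq> stable_hull M E K"
proof
  fix x assume "K \<subseteq> carrier E" "x \<in> K"
  moreover have "partition_seq M (\<lambda>k. if k = 0 then space M else {})"
    by (auto simp: partition_seq_def)
  ultimately show "x \<in> stable_hull M E K"
    unfolding stable_hull_def is_concatenation_def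
    by (intro CollectI conjI exI[of _ "\<lambda>_. x"] exI[of _ "\<lambda>k. if k = 0 then space M else {}"]) auto
qed

text \<open>A concatenation of concatenations is a concatenation along the refined partition.\<close>

lemma relatively_stable_stable_hull:
  assumes K: "K \<subseteq> carrier E"
  shows "relatively_stable M E (stable_hull M E K)"
  unfolding relatively_stable_def
proof (intro conjI allI impI)
  show "stable_hull M E K \<subseteq> carrier E" by (auto simp: stable_hull_def)
  fix y B z assume *: "range y \<subseteq> stable_hull M E K \<and> partition_seq M B \<and> is_concatenation M E y B z"
  then have "\<forall>k. \<exists>x A. range x \<subseteq> K \<and> partition_seq M A \<and> is_concatenation M E x A (y k)"
    unfolding stable_hull_def by blast
  then obtain x A where xA: "\<And>k. range (x k) \<subseteq> K" "\<And>k. partition_seq M (A k)"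
    "\<And>k. is_concatenation M E (x k) (A k) (y k)" by metis
  have z [simp]: "z \<in> carrier E" using * by (simp add: is_concatenation_def)
  let ?C = "\<lambda>n. B (fst (prod_decode n)) \<inter> A (fst (prod_decode n)) (snd (prod_decode n))"
  let ?x = "\<lambda>n. x (fst (prod_decode n)) (snd (prod_decode n))"
  have "indicator (B k \<inter> A k j) *\<^sub>E z = indicator (B k \<inter> A k j) *\<^sub>E x k j" for k j
  proof -
    have [simp]: "B k \<in> sets M" "A k j \<in> sets M" using * xA(2)[of k] by (auto intro: partition_seq_sets)
    have [simp]: "indicat_real (B k) \<in> borel_measurable M" "indicat_real (A k j) \<in> borel_measurable M"
      by (rule borel_measurable_indicator, simp)+
    have [simp]: "y k \<in> carrier E" "x k j \<in> carrier E"
      using xA(1,3)[of k] K by (auto simp: is_concatenation_def)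
    have split: "indicator (B k \<inter> A k j) *\<^sub>E v = indicator (A k j) *\<^sub>E indicator (B k) *\<^sub>E v"
      "indicator (B k \<inter> A k j) *\<^sub>E v = indicator (B k) *\<^sub>E indicator (A k j) *\<^sub>E v"
      if "v \<in> carrier E" for v
      using that by (simp_all add: scale_scale indicator_inter_arith[abs_def] mult.commute)
    have zy: "indicator (B k) *\<^sub>E z = indicator (B k) *\<^sub>E y k"
      using * by (simp add: is_concatenation_def indicator_scale)
    have yx: "indicator (A k j) *\<^sub>E y k = indicator (A k j) *\<^sub>E x k j"
      using xA(3)[of k] by (simp add: is_concatenation_def indicator_scale)
    have "indicator (B k \<inter> A k j) *\<^sub>E z = indicator (B k \<inter> A k j) *\<^sub>E y k" by (simp add: split(1) zy)
    also have "\<dots> = indicator (B k \<inter> A k j) *\<^sub>E x k j" by (simp add: split(2) yx)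
    finally show ?thesis .
  qed
  then have "is_concatenation M E ?x ?C z" by (simp add: is_concatenation_def indicator_scale)
  moreover have "partition_seq M ?C" using * xA(2) by (intro partition_seq_refine) auto
  moreover have "range ?x \<subseteq> K" using xA(1) by auto
  ultimately show "z \<in> stable_hull M E K" unfolding stable_hull_def using z by blast
qed

lemma relatively_stable_ball:
  assumes e: "e \<in> borel_measurable M"
  shows "relatively_stable M E {y \<in> carrier E. AE w in M. N y w \<le> e w}"
  unfolding relatively_stable_def
proof (intro conjI allI impI)
  fix y A z
  assume *: "range y \<subseteq> {y \<in> carrier E. AE w in M. N y w \<le> e w} \<and> partition_seq M A \<and>
    is_concatenation M E y A z"
  then have z: "z \<in> carrier E" and y: "y k \<in> carrier E" "AE w in M. N (y k) w \<le> e w" for k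
    by (auto simp: is_concatenation_def)
  have "AE w in M. w \<in> A k \<longrightarrow> N z w \<le> e w" for k
  proof -
    have A: "A k \<in> sets M" using * by (auto intro: partition_seq_sets)
    have "indicator (A k) *\<^sub>E z = indicator (A k) *\<^sub>E y k"
      using * by (simp add: is_concatenation_def indicator_scale)
    with N_scale[of "indicator (A k)" z] N_scale[of "indicator (A k)" "y k"] A z y(1)
    have "AE w in M. N (indicator (A k) *\<^sub>E z) w = \<bar>indicator (A k) w\<bar> * N z w"
      "AE w in M. N (indicator (A k) *\<^sub>E z) w = \<bar>indicator (A k) w\<bar> * N (y k) w" by simp_all
    with y(2)[of k] show ?thesis by eventually_elim auto
  qed
  then have "AE w in M. \<forall>k. w \<in> A k \<longrightarrow> N z w \<le> e w" unfolding AE_all_countable ..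
  moreover have "AE w in M. w \<in> (\<Union>k. A k)"
    using * by (intro AE_I'[of "space M - (\<Union>k. A k)"]) (auto simp: partition_seq_def)
  ultimately have "AE w in M. N z w \<le> e w" by eventually_elim auto
  with z show "z \<in> {y \<in> carrier E. AE w in M. N y w \<le> e w}" by simp
qed auto

text \<open>
  The \<open>c n\<close> cannot simply be concatenated along the events where they approximate \<open>l\<close>, since the
  concatenation need not exist. Instead \<open>l\<close> is exhibited as a concatenation of elements of
  \<open>stable_hull M E K\<close> plus the ball; the correction \<open>r n\<close> is cut off outside the \<open>n\<close>-th event so
  that it stays in the ball. Stability of the sum then splits \<open>l\<close> itself.
\<close>

lemma glue_approximations:
  assumes stable: "sum_preserves_stability M E" and K: "K \<subseteq> carrier E"
    and l [simp]: "l \<in> carrier E" and c: "\<And>n :: nat. c n \<in> K"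
    and e [measurable]: "e \<in> borel_measurable M" and e0: "AE w in M. 0 \<le> e w"
    and near: "AE w in M. \<exists>n. N (l \<ominus> c n) w \<le> e w"
  shows "\<exists>z\<in>stable_hull M E K. AE w in M. N (l \<ominus> z) w \<le> e w"
proof -
  let ?B = "{y \<in> carrier E. AE w in M. N y w \<le> e w}"
  have cE [simp]: "c n \<in> carrier E" for n using c K by blast
  define A where "A n = {w \<in> space M. N (l \<ominus> c n) w \<le> e w}" for n
  have A [measurable]: "A n \<in> sets M" for n
  proof -
    have [measurable]: "N (l \<ominus> c n) \<in> borel_measurable M" by simp
    show ?thesis unfolding A_def by measurable
  qed
  have dA [measurable]: "disjointed A n \<in> sets M" for n 
    using range_subsetD[OF sets.range_disjointed_sets[of A M]] A by blast
  have part: "partition_seq M (disjointed A)"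
    unfolding partition_seq_def
  proof (intro conjI allI impI)
    show "range (disjointed A) \<subseteq> sets M" using dA by auto
    show "disjointed A i \<inter> disjointed A j \<in> null_sets M" if "i \<noteq> j" for i j
      using disjoint_family_disjointed[of A] that by (simp add: disjoint_family_on_def)
    have "AE w in M. w \<in> (\<Union>k. A k)" using near by (auto simp: A_def elim!: AE_mp intro!: AE_I2)
    then show "space M - (\<Union>k. disjointed A k) \<in> null_sets M"
      using AE_iff_null[of M "\<lambda>w. w \<in> (\<Union>k. A k)"]
      by (simp add: UN_disjointed_eq set_diff_eq)
  qed
  define r where "r n = indicator (disjointed A n) *\<^sub>E (l \<ominus> c n)" for n
  have r: "r n \<in> ?B" for n
  proof -
    have "AE w in M. N (r n) w = \<bar>indicator (disjointed A n) w\<bar> * N (l \<ominus> c n) w"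
      unfolding r_def by (intro N_scale) auto
    with e0 AE_space have "AE w in M. N (r n) w \<le> e w"
    proof eventually_elim
      case (elim w)
      then show ?case using disjointed_subset[of A n] by (auto simp: A_def indicator_def)
    qed
    then show ?thesis unfolding r_def by auto
  qed
  let ?S = "set_add E (stable_hull M E K) ?B"
  have S: "relatively_stable M E ?S"
    using stable relatively_stable_stable_hull[OF K] relatively_stable_ball[OF e]
    unfolding sum_preserves_stability_def by blast
  have "c n \<oplus> r n \<in> ?S" for n
    using r[of n] c[of n] subset_stable_hull[OF K] unfolding set_add_def' by blast
  then have in_S: "range (\<lambda>n. c n \<oplus> r n) \<subseteq> ?S" by blast
  have conc: "is_concatenation M E (\<lambda>n. c n \<oplus> r n) (disjointed A) l"
    unfolding is_concatenation_def
  proof (intro conjI allI l)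
    fix n
    let ?i = "indicator (disjointed A n) :: 'w \<Rightarrow> real"
    have "?i *\<^sub>E (c n \<oplus> r n) = ?i *\<^sub>E c n \<oplus> ?i *\<^sub>E (l \<ominus> c n)"
      unfolding r_def by (simp add: scale_add_right scale_scale flip: indicator_inter_arith[abs_def])
    also have "\<dots> = ?i *\<^sub>E (c n \<oplus> (l \<ominus> c n))" by (simp add: scale_add_right)
    also have "c n \<oplus> (l \<ominus> c n) = l"
      by (simp add: M.minus_eq M.a_lcomm[of "c n" l] M.r_neg)
    finally show "L0_indicator M (disjointed A n) \<odot> l = L0_indicator M (disjointed A n) \<odot> (c n \<oplus> r n)"
      by (simp add: indicator_scale)
  qed
  have "l \<in> ?S" by (rule relatively_stableD[OF S in_S part conc])
  then obtain z y where z: "z \<in> stable_hull M E K" and y: "y \<in> ?B" and l_eq: "l = z \<oplus> y"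
    unfolding set_add_def' by blast
  have "z \<in> carrier E" using z by (simp add: stable_hull_def)
  then have "l \<ominus> z = y"
    using y unfolding l_eq by (simp add: M.minus_eq M.a_comm[of z y] M.a_assoc M.r_neg)
  with z y show ?thesis by blast
qed


end

section \<open>Convex hulls\<close>

text \<open>
  Two finite families indexed by natural numbers are merged by moving one to the even and the other
  to the odd numbers.
\<close>

lemma finsum_interleave:
  assumes "abelian_monoid H" "finite I" "finite J" "f \<in> I \<rightarrow> carrier H" "g \<in> J \<rightarrow> carrier H"
  shows "(\<Oplus>\<^bsub>H\<^esub>k\<in>(\<lambda>i. 2 * i) ` I \<union> (\<lambda>j. Suc (2 * j)) ` J. if even k then f (k div 2) else g (k div 2)) =
    (\<Oplus>\<^bsub>H\<^esub>i\<in>I. f i) \<oplus>\<^bsub>H\<^esub> (\<Oplus>\<^bsub>H\<^esub>j\<in>J. g j)"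
proof -
  interpret H: abelian_monoid H by fact
  let ?h = "\<lambda>k. if even k then f (k div 2) else g (k div 2)"
  have closed: "?h \<in> (\<lambda>i. 2 * i) ` I \<rightarrow> carrier H" "?h \<in> (\<lambda>j. Suc (2 * j)) ` J \<rightarrow> carrier H"
    using assms by (auto simp: Pi_iff)
  have "(\<lambda>i :: nat. 2 * i) ` I \<inter> (\<lambda>j. Suc (2 * j)) ` J = {}" by auto presburger
  then have "(\<Oplus>\<^bsub>H\<^esub>k\<in>(\<lambda>i. 2 * i) ` I \<union> (\<lambda>j. Suc (2 * j)) ` J. ?h k) =
      (\<Oplus>\<^bsub>H\<^esub>k\<in>(\<lambda>i. 2 * i) ` I. ?h k) \<oplus>\<^bsub>H\<^esub> (\<Oplus>\<^bsub>H\<^esub>k\<in>(\<lambda>j. Suc (2 * j)) ` J. ?h k)"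
    using assms closed by (intro H.finsum_Un_disjoint) auto
  also have "(\<Oplus>\<^bsub>H\<^esub>k\<in>(\<lambda>i. 2 * i) ` I. ?h k) = (\<Oplus>\<^bsub>H\<^esub>i\<in>I. ?h (2 * i))"
    by (rule H.finsum_reindex[OF closed(1)]) (auto simp: inj_on_def)
  also have "\<dots> = (\<Oplus>\<^bsub>H\<^esub>i\<in>I. f i)" by simp
  also have "(\<Oplus>\<^bsub>H\<^esub>k\<in>(\<lambda>j. Suc (2 * j)) ` J. ?h k) = (\<Oplus>\<^bsub>H\<^esub>j\<in>J. ?h (Suc (2 * j)))"
    by (rule H.finsum_reindex[OF closed(2)]) (auto simp: inj_on_def)
  also have "\<dots> = (\<Oplus>\<^bsub>H\<^esub>j\<in>J. g j)" by simp
  finally show ?thesis .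
qed

lemma L0_nonneg_mult: "a \<in> L0_nonneg M \<Longrightarrow> b \<in> L0_nonneg M \<Longrightarrow> a \<otimes>\<^bsub>L0 M\<^esub> b \<in> L0_nonneg M"
proof -
  assume "a \<in> L0_nonneg M" "b \<in> L0_nonneg M"
  then obtain f g where fg: "f \<in> borel_measurable M" "a = L0_class M f" "AE w in M. 0 \<le> f w"
      "g \<in> borel_measurable M" "b = L0_class M g" "AE w in M. 0 \<le> g w"
    by (auto simp: L0_nonneg_iff)
  from fg(3,6) have "AE w in M. 0 \<le> f w * g w" by eventually_elim simp
  with fg show ?thesis
    unfolding L0_nonneg_iff by (intro bexI[of _ "\<lambda>w. f w * g w"]) (auto simp: L0_mult)
qed

context L0_seminormed
begin

lemma L0_convex_hull_subset: "S \<subseteq> carrier E \<Longrightarrow> L0_convex_hull M E S \<subseteq> carrier E"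
proof safe
  fix z assume S: "S \<subseteq> carrier E" and "z \<in> L0_convex_hull M E S"
  then obtain I :: "nat set" and \<eta> x where *: "x \<in> I \<rightarrow> S" "\<eta> \<in> I \<rightarrow> L0_nonneg M"
    "z = (\<Oplus>i\<in>I. \<eta> i \<odot> x i)"
    unfolding L0_convex_hull_def by blast
  then show "z \<in> carrier E" using S by (auto intro!: M.finsum_closed simp: L0_nonneg_carrier Pi_iff subset_eq)
qed

lemma subset_L0_convex_hull: "S \<subseteq> carrier E \<Longrightarrow> S \<subseteq> L0_convex_hull M E S"
proof
  fix x assume S: "S \<subseteq> carrier E" and x: "x \<in> S"
  then have "x \<in> carrier E" by blast
  then have "x = (\<Oplus>i\<in>{0 :: nat}. \<one>\<^bsub>L0 M\<^esub> \<odot> x)" "(\<Oplus>\<^bsub>L0 M\<^esub>i\<in>{0 :: nat}. \<one>\<^bsub>L0 M\<^esub>) = \<one>\<^bsub>L0 M\<^esub>"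
    by simp_all
  then show "x \<in> L0_convex_hull M E S"
    unfolding L0_convex_hull_def using x L0_pos_nonneg[OF L0_one_pos]
    by (intro CollectI exI[of _ "{0}"] exI[of _ "\<lambda>_. \<one>\<^bsub>L0 M\<^esub>"] exI[of _ "\<lambda>_. x"]) auto
qed

lemma L0_convex_hull_convex:
  assumes S: "S \<subseteq> carrier E" and c: "c \<in> L0_convex_hull M E S" and d: "d \<in> L0_convex_hull M E S"
    and \<theta> [measurable]: "\<theta> \<in> borel_measurable M" and \<theta>01: "\<And>w. 0 \<le> \<theta> w \<and> \<theta> w \<le> 1"
  shows "\<theta> *\<^sub>E c \<oplus> (\<lambda>w. 1 - \<theta> w) *\<^sub>E d \<in> L0_convex_hull M E S"
proof -
  obtain I :: "nat set" and \<eta> x where I: "finite I" "x \<in> I \<rightarrow> S" "\<eta> \<in> I \<rightarrow> L0_nonneg M"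
      "(\<Oplus>\<^bsub>L0 M\<^esub>i\<in>I. \<eta> i) = \<one>\<^bsub>L0 M\<^esub>" "c = (\<Oplus>i\<in>I. \<eta> i \<odot> x i)"
    using c unfolding L0_convex_hull_def by blast
  obtain J :: "nat set" and \<zeta> y where J: "finite J" "y \<in> J \<rightarrow> S" "\<zeta> \<in> J \<rightarrow> L0_nonneg M"
      "(\<Oplus>\<^bsub>L0 M\<^esub>j\<in>J. \<zeta> j) = \<one>\<^bsub>L0 M\<^esub>" "d = (\<Oplus>j\<in>J. \<zeta> j \<odot> y j)"
    using d unfolding L0_convex_hull_def by blast
  define s t where "s = L0_class M \<theta>" and "t = L0_class M (\<lambda>w. 1 - \<theta> w)"
  have st_nonneg: "s \<in> L0_nonneg M" "t \<in> L0_nonneg M"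
    using \<theta>01 by (simp_all add: s_def t_def L0_nonneg_def L0_class_in_carrier L0_zero L0_le_class)
  note st = st_nonneg[THEN L0_nonneg_carrier]
  have st1: "s \<oplus>\<^bsub>L0 M\<^esub> t = \<one>\<^bsub>L0 M\<^esub>" by (simp add: s_def t_def L0_add L0_one)
  have \<eta>: "\<eta> \<in> I \<rightarrow> carrier (L0 M)" and x: "x \<in> I \<rightarrow> carrier E"
    and \<zeta>: "\<zeta> \<in> J \<rightarrow> carrier (L0 M)" and y: "y \<in> J \<rightarrow> carrier E"
    using I J S by (auto simp: Pi_iff L0_nonneg_carrier)
  let ?K = "(\<lambda>i. 2 * i) ` I \<union> (\<lambda>j. Suc (2 * j)) ` J"
  define \<kappa> where "\<kappa> k = (if even k then s \<otimes>\<^bsub>L0 M\<^esub> \<eta> (k div 2) else t \<otimes>\<^bsub>L0 M\<^esub> \<zeta> (k div 2))" for k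
  define v where "v k = (if even k then x (k div 2) else y (k div 2))" for k
  have "(\<Oplus>\<^bsub>L0 M\<^esub>k\<in>?K. \<kappa> k) = (\<Oplus>\<^bsub>L0 M\<^esub>i\<in>I. s \<otimes>\<^bsub>L0 M\<^esub> \<eta> i) \<oplus>\<^bsub>L0 M\<^esub> (\<Oplus>\<^bsub>L0 M\<^esub>j\<in>J. t \<otimes>\<^bsub>L0 M\<^esub> \<zeta> j)"
    unfolding \<kappa>_def using I J \<eta> \<zeta> st
    by (intro finsum_interleave) (auto simp: Pi_iff R.abelian_monoid_axioms)
  also have "\<dots> = \<one>\<^bsub>L0 M\<^esub>"
    using I J \<eta> \<zeta> st st1 by (simp flip: R.finsum_rdistr)
  finally have \<kappa>1: "(\<Oplus>\<^bsub>L0 M\<^esub>k\<in>?K. \<kappa> k) = \<one>\<^bsub>L0 M\<^esub>" .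
  have "(\<Oplus>k\<in>?K. \<kappa> k \<odot> v k) = (\<Oplus>k\<in>?K. if even k then s \<odot> (\<eta> (k div 2) \<odot> x (k div 2)) else t \<odot> (\<zeta> (k div 2) \<odot> y (k div 2)))"
    using st \<eta> \<zeta> x y by (intro M.finsum_cong') (auto simp: \<kappa>_def v_def smult_assoc1 Pi_iff)
  also have "\<dots> = (\<Oplus>i\<in>I. s \<odot> (\<eta> i \<odot> x i)) \<oplus> (\<Oplus>j\<in>J. t \<odot> (\<zeta> j \<odot> y j))"
    using I J \<eta> \<zeta> st x y by (intro finsum_interleave) (auto simp: Pi_iff M.abelian_monoid_axioms)
  also have "\<dots> = \<theta> *\<^sub>E c \<oplus> (\<lambda>w. 1 - \<theta> w) *\<^sub>E d"
    using I J \<eta> \<zeta> st x y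
    by (subst (1 2) finsum_smult_ldistr[symmetric]) (auto simp: scale_def s_def t_def Pi_iff)
  finally have sum: "(\<Oplus>k\<in>?K. \<kappa> k \<odot> v k) = \<theta> *\<^sub>E c \<oplus> (\<lambda>w. 1 - \<theta> w) *\<^sub>E d" .
  have "v \<in> ?K \<rightarrow> S" "\<kappa> \<in> ?K \<rightarrow> L0_nonneg M"
    using I J st_nonneg by (auto simp: v_def \<kappa>_def Pi_iff intro: L0_nonneg_mult)
  with \<kappa>1 sum I(1) J(1) show ?thesis
    unfolding L0_convex_hull_def
    by (intro CollectI exI[of _ ?K] exI[of _ \<kappa>] exI[of _ v]) auto
qed

end

theorem theorem2p1:
  fixes M :: "'w measure"
    and E :: "(('w \<Rightarrow> real) set, 'e, 'm) module_scheme"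
    and nrm :: "'e \<Rightarrow> ('w \<Rightarrow> real) set"
    and G :: "'g set" and leq :: "'g \<Rightarrow> 'g \<Rightarrow> bool"
    and x :: "'g \<Rightarrow> 'e" and l :: 'e
    and \<epsilon> :: "('w \<Rightarrow> real) set"
  assumes "prob_space M"
    and "L0_normed_module M E nrm"
    and "sum_preserves_stability M E"
    and "directed_set G leq"
    and "x \<in> G \<rightarrow> carrier E"
    and "l \<in> carrier E"
    and "limitin (weak_topology M E nrm) x l (net_filter G leq)"
    and "\<epsilon> \<in> L0_pos M"
  shows "\<exists>z\<in>stable_hull M E (L0_convex_hull M E (x ` G)). L0_le M (nrm (l \<ominus>\<^bsub>E\<^esub> z)) \<epsilon>"
proof -
  interpret L0_seminormed M E nrm
    using assms(1,2) unfolding L0_seminormed_def L0_seminormed_axioms_def L0_normed_module_def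
      L0_norm_def by blast
  obtain e where e [measurable]: "e \<in> borel_measurable M" and \<epsilon>: "\<epsilon> = L0_class M e" and e_pos: "AE w in M. 0 < e w"
    using assms(8) by (auto simp: L0_pos_iff)
  note l [simp] = assms(6)
  define C where "C = L0_convex_hull M E (x ` G)"
  have xG: "x ` G \<subseteq> carrier E" using assms(5) by auto
  have xC: "x g \<in> C" if "g \<in> G" for g using subset_L0_convex_hull[OF xG] that by (auto simp: C_def)
  have C: "C \<subseteq> carrier E" unfolding C_def by (rule L0_convex_hull_subset[OF xG])
  have CE [simp]: "c \<in> carrier E" if "c \<in> C" for c using C that by blast
  have combine: "\<theta> *\<^sub>E (l \<ominus>\<^bsub>E\<^esub> c) \<oplus>\<^bsub>E\<^esub> (\<lambda>w. 1 - \<theta> w) *\<^sub>E (l \<ominus>\<^bsub>E\<^esub> d) \<in> (\<lambda>c. l \<ominus>\<^bsub>E\<^esub> c) ` C"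
    if c: "c \<in> C" and d: "d \<in> C" and \<theta> [measurable]: "\<theta> \<in> borel_measurable M"
      and \<theta>01: "\<And>w. 0 \<le> \<theta> w \<and> \<theta> w \<le> 1" for c d \<theta>
  proof (rule image_eqI)
    show "\<theta> *\<^sub>E c \<oplus>\<^bsub>E\<^esub> (\<lambda>w. 1 - \<theta> w) *\<^sub>E d \<in> C"
      using L0_convex_hull_convex[OF xG _ _ \<theta> \<theta>01] c d by (simp add: C_def)
    have [simp]: "c \<in> carrier E" "d \<in> carrier E" using c d by auto
    have "\<theta> *\<^sub>E (l \<ominus>\<^bsub>E\<^esub> c) \<oplus>\<^bsub>E\<^esub> (\<lambda>w. 1 - \<theta> w) *\<^sub>E (l \<ominus>\<^bsub>E\<^esub> d) =
        (\<theta> *\<^sub>E l \<oplus>\<^bsub>E\<^esub> (\<lambda>w. 1 - \<theta> w) *\<^sub>E l) \<ominus>\<^bsub>E\<^esub> (\<theta> *\<^sub>E c \<oplus>\<^bsub>E\<^esub> (\<lambda>w. 1 - \<theta> w) *\<^sub>E d)"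
      by (simp add: M.minus_eq minus_eq_scale scale_add_right scale_scale M.a_ac)
    also have "\<theta> *\<^sub>E l \<oplus>\<^bsub>E\<^esub> (\<lambda>w. 1 - \<theta> w) *\<^sub>E l = l" by (simp add: scale_add_left)
    finally show "\<theta> *\<^sub>E (l \<ominus>\<^bsub>E\<^esub> c) \<oplus>\<^bsub>E\<^esub> (\<lambda>w. 1 - \<theta> w) *\<^sub>E (l \<ominus>\<^bsub>E\<^esub> d) =
        l \<ominus>\<^bsub>E\<^esub> (\<theta> *\<^sub>E c \<oplus>\<^bsub>E\<^esub> (\<lambda>w. 1 - \<theta> w) *\<^sub>E d)" .
  qed
  obtain g0 where g0: "g0 \<in> G" using assms(4) by (auto simp: directed_set_def)
  define S where "S = (\<lambda>c. N (l \<ominus>\<^bsub>E\<^esub> c)) ` C"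
  have S: "S \<noteq> {}" "S \<subseteq> borel_measurable M" using xC[OF g0] by (auto simp: S_def)
  have S_min: "\<exists>h\<in>S. AE w in M. h w \<le> f w \<and> h w \<le> f' w" if f: "f \<in> S" and f': "f' \<in> S" for f f'
  proof -
    obtain c c' where c: "c \<in> C" "f = N (l \<ominus>\<^bsub>E\<^esub> c)" and c': "c' \<in> C" "f' = N (l \<ominus>\<^bsub>E\<^esub> c')"
      using f f' by (auto simp: S_def)
    have [measurable]: "f \<in> borel_measurable M" "f' \<in> borel_measurable M" using f f' S by auto
    define \<theta> where "\<theta> w = (if f w \<le> f' w then 1 else 0 :: real)" for w
    have \<theta> [measurable]: "\<theta> \<in> borel_measurable M" unfolding \<theta>_def by measurable
    let ?a = "\<theta> *\<^sub>E (l \<ominus>\<^bsub>E\<^esub> c)" and ?b = "(\<lambda>w. 1 - \<theta> w) *\<^sub>E (l \<ominus>\<^bsub>E\<^esub> c')"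
    have "?a \<oplus>\<^bsub>E\<^esub> ?b \<in> (\<lambda>c. l \<ominus>\<^bsub>E\<^esub> c) ` C"
      by (rule combine[OF c(1) c'(1) \<theta>]) (simp add: \<theta>_def)
    then have "N (?a \<oplus>\<^bsub>E\<^esub> ?b) \<in> S" by (auto simp: S_def)
    moreover have "AE w in M. N ?a w = \<bar>\<theta> w\<bar> * f w" "AE w in M. N ?b w = \<bar>1 - \<theta> w\<bar> * f' w"
      "AE w in M. N (?a \<oplus>\<^bsub>E\<^esub> ?b) w \<le> N ?a w + N ?b w"
      unfolding c(2) c'(2) using c(1) c'(1) by (auto intro!: N_scale N_triangle)
    then have "AE w in M. N (?a \<oplus>\<^bsub>E\<^esub> ?b) w \<le> f w \<and> N (?a \<oplus>\<^bsub>E\<^esub> ?b) w \<le> f' w"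
      by eventually_elim (auto simp: \<theta>_def split: if_splits)
    ultimately show ?thesis by blast
  qed
  have S_nonneg: "AE w in M. 0 \<le> f w" if "f \<in> S" for f using that N_nonneg by (auto simp: S_def)
  obtain F :: "nat \<Rightarrow> 'w \<Rightarrow> real" and r where F: "range F \<subseteq> S" and r [measurable]: "r \<in> borel_measurable M"
    and inf: "AE w in M. bdd_below (range (\<lambda>n. F n w)) \<and> r w = (INF n. F n w)"
    and r_le: "\<And>f. f \<in> S \<Longrightarrow> AE w in M. r w \<le> f w"
  proof (rule directed_essential_infimum[OF S S_min S_nonneg])
    fix F :: "nat \<Rightarrow> 'w \<Rightarrow> real" and c
    assume "range F \<subseteq> S" "c \<in> borel_measurable M"
      "AE w in M. bdd_below (range (\<lambda>n. F n w)) \<and> c w = (INF n. F n w)"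
      "\<And>f. f \<in> S \<Longrightarrow> AE w in M. c w \<le> f w"
    then show thesis by (rule that)
  qed
  have "\<forall>n. \<exists>c. c \<in> C \<and> F n = N (l \<ominus>\<^bsub>E\<^esub> c)" using F by (auto simp: S_def)
  then obtain c where c: "\<And>n. c n \<in> C" "\<And>n. F n = N (l \<ominus>\<^bsub>E\<^esub> c n)" by metis
  \<comment> \<open>A lower bound for \<open>N\<close> on \<open>l - C\<close> that is nonzero exactly on the event to be shown null.\<close>
  define u where "u w = (if e w \<le> r w then e w else 0)" for w
  have u [measurable]: "u \<in> borel_measurable M" unfolding u_def by measurable
  have "AE w in M. r w < e w"
  proof -
    obtain \<phi> where \<phi>: "linear_functional \<phi>" and bound: "\<And>x. x \<in> carrier E \<Longrightarrow> AE w in M. \<bar>\<phi> x w\<bar> \<le> N x w"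
      and u_le: "\<And>c. c \<in> C \<Longrightarrow> AE w in M. u w \<le> \<phi> (l \<ominus>\<^bsub>E\<^esub> c) w"
    proof (rule separate_convex_set_from_zero[of "(\<lambda>c. l \<ominus>\<^bsub>E\<^esub> c) ` C" u])
      show "(\<lambda>c. l \<ominus>\<^bsub>E\<^esub> c) ` C \<noteq> {}" using xC[OF g0] by auto
      show "(\<lambda>c. l \<ominus>\<^bsub>E\<^esub> c) ` C \<subseteq> carrier E" by auto
      fix y assume "y \<in> (\<lambda>c. l \<ominus>\<^bsub>E\<^esub> c) ` C"
      then have "N y \<in> S" by (auto simp: S_def)
      from r_le[OF this] S_nonneg[OF this] show "AE w in M. u w \<le> N y w"
        by eventually_elim (auto simp: u_def)
    next
      fix \<phi> assume *: "linear_functional \<phi>" "\<And>x. x \<in> carrier E \<Longrightarrow> AE w in M. \<bar>\<phi> x w\<bar> \<le> N x w"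
        "\<And>y. y \<in> (\<lambda>c. l \<ominus>\<^bsub>E\<^esub> c) ` C \<Longrightarrow> AE w in M. u w \<le> \<phi> y w"
      show thesis by (rule that[OF *(1,2)]) (auto intro: *(3))
    qed (auto intro: combine)
    have e2: "(\<lambda>w. e w / 2) \<in> borel_measurable M" "AE w in M. 0 < e w / 2" using e_pos by auto
    obtain g where g: "g \<in> G" and tail: "\<forall>h\<in>G. leq g h \<longrightarrow> (AE w in M. \<bar>\<phi> (x h) w - \<phi> l w\<bar> < e w / 2)"
      using weak_limit_eventually[OF \<phi> bound assms(7) l e2]
      unfolding eventually_net_filter[OF assms(4)] by blast
    moreover have "leq g g" using assms(4) g unfolding directed_set_def by blast
    ultimately have near: "AE w in M. \<bar>\<phi> (x g) w - \<phi> l w\<bar> < e w / 2" by blast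
    have xg: "x g \<in> C" using xC[OF g] .
    have "AE w in M. \<phi> ((l \<ominus>\<^bsub>E\<^esub> x g) \<oplus>\<^bsub>E\<^esub> x g) w = \<phi> (l \<ominus>\<^bsub>E\<^esub> x g) w + \<phi> (x g) w"
      using xg by (intro linear_functionalD(2)[OF \<phi>]) auto
    moreover have "(l \<ominus>\<^bsub>E\<^esub> x g) \<oplus>\<^bsub>E\<^esub> x g = l"
      using xg by (simp add: M.minus_eq M.a_assoc M.l_neg)
    ultimately have "AE w in M. \<phi> l w = \<phi> (l \<ominus>\<^bsub>E\<^esub> x g) w + \<phi> (x g) w" by simp
    with near u_le[OF xg] e_pos show ?thesis
      by eventually_elim (auto simp: u_def split: if_splits)
  qed
  with inf have "AE w in M. \<exists>n. N (l \<ominus>\<^bsub>E\<^esub> c n) w \<le> e w"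
  proof eventually_elim
    case (elim w)
    then have "(INF n. F n w) < e w" by simp
    then obtain n where "F n w < e w" using elim(1) by (subst (asm) cINF_less_iff) auto
    then show ?case unfolding c(2) by (intro exI[of _ n]) simp
  qed
  moreover have "AE w in M. 0 \<le> e w" using e_pos by eventually_elim simp
  ultimately obtain z where z: "z \<in> stable_hull M E C" "AE w in M. N (l \<ominus>\<^bsub>E\<^esub> z) w \<le> e w"
    using glue_approximations[of C l c e, OF assms(3) C l c(1) e] by blast
  then have "z \<in> carrier E" by (simp add: stable_hull_def)
  then have "L0_le M (nrm (l \<ominus>\<^bsub>E\<^esub> z)) \<epsilon>" using z(2) e by (simp add: nrm_eq \<epsilon> L0_le_class)
  with z(1) show ?thesis unfolding C_def by blast
qed

end
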